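(* Every finite, simple, connected graph $G$ that is bipartite, cubic (3-regular) and planar is dispersable; that is, its matching book thickness satisfies $mbt(G)=\Delta(G)=3$.
   Context: A book embedding of a graph $G$ places the vertices of $G$ in some linear order on a line (the spine) and assigns each edge to one of several half-planes (pages) bounded by the spine, so that no two edges assigned to the same page cross (equivalently, with respect to the vertex order, no two edges $(a,b)$, $(c,d)$ on the same page satisfy $a<c<b<d$). A book embedding is matching if on each page the edges assigned to it form a matching (every vertex is incident to at most one edge of that page). The matching book thickness $mbt(G)$ is the minimum number of pages of a matching book embedding of $G$. A graph $G$ with maximum degree $\Delta(G)$ is dispersable if $mbt(G)=\Delta(G)$ (equivalently, it has a proper $\Delta(G)$-edge-colouring and a $\Delta(G)$-page book embedding in which all edges of one colour lie on the same page). Throughout the paper, graphs are simple, undirected and connected. *)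

theory Defs
  imports "HOL-Analysis.Analysis"
begin

definition simple_graph :: "'a set \<Rightarrow> 'a set set \<Rightarrow> bool" where
  "simple_graph V E \<longleftrightarrow> finite V \<and> (\<forall>e\<in>E. e \<subseteq> V \<and> card e = 2)"

definition degree :: "'a set set \<Rightarrow> 'a \<Rightarrow> nat" where
  "degree E v = card {e\<in>E. v \<in> e}"

definition max_degree :: "'a set \<Rightarrow> 'a set set \<Rightarrow> nat" where
  "max_degree V E = Max (degree E ` V)"

definition adj :: "'a set set \<Rightarrow> 'a \<Rightarrow> 'a \<Rightarrow> bool" where
  "adj E u v \<longleftrightarrow> {u, v} \<in> E"

definition connected_graph :: "'a set \<Rightarrow> 'a set set \<Rightarrow> bool" where
  "connected_graph V E \<longleftrightarrow> V \<noteq> {} \<and> (\<forall>u\<in>V. \<forall>v\<in>V. (adj E)\<^sup>*\<^sup>* u v)"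

definition bipartite :: "'a set \<Rightarrow> 'a set set \<Rightarrow> bool" where
  "bipartite V E \<longleftrightarrow> (\<exists>A. A \<subseteq> V \<and> (\<forall>e\<in>E. card (e \<inter> A) = 1))"

definition cubic :: "'a set \<Rightarrow> 'a set set \<Rightarrow> bool" where
  "cubic V E \<longleftrightarrow> (\<forall>v\<in>V. degree E v = 3)"

definition planar :: "'a set \<Rightarrow> 'a set set \<Rightarrow> bool" where
  "planar V E \<longleftrightarrow> (\<exists>(pos :: 'a \<Rightarrow> complex) (\<gamma> :: 'a set \<Rightarrow> real \<Rightarrow> complex).
      inj_on pos V \<and>
      (\<forall>e\<in>E. arc (\<gamma> e) \<and> {pathstart (\<gamma> e), pathfinish (\<gamma> e)} = pos ` e \<and>
               path_image (\<gamma> e) \<inter> pos ` V = pos ` e) \<and>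
      (\<forall>e\<in>E. \<forall>f\<in>E. e \<noteq> f \<longrightarrow> path_image (\<gamma> e) \<inter> path_image (\<gamma> f) \<subseteq> pos ` (e \<inter> f)))"

definition crossing :: "('a \<Rightarrow> nat) \<Rightarrow> 'a set \<Rightarrow> 'a set \<Rightarrow> bool" where
  "crossing ord e f \<longleftrightarrow> (\<exists>a b c d. e = {a, b} \<and> f = {c, d} \<and>
       ord a < ord c \<and> ord c < ord b \<and> ord b < ord d)"

definition matching_book_embedding ::
  "'a set \<Rightarrow> 'a set set \<Rightarrow> nat \<Rightarrow> ('a \<Rightarrow> nat) \<Rightarrow> ('a set \<Rightarrow> nat) \<Rightarrow> bool" where
  "matching_book_embedding V E k ord page \<longleftrightarrow>
     inj_on ord V \<and>
     (\<forall>e\<in>E. page e < k) \<and>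
     (\<forall>e\<in>E. \<forall>f\<in>E. e \<noteq> f \<and> page e = page f \<longrightarrow>
         e \<inter> f = {} \<and> \<not> crossing ord e f)"

definition mbt :: "'a set \<Rightarrow> 'a set set \<Rightarrow> nat" where
  "mbt V E = (LEAST k. \<exists>ord page. matching_book_embedding V E k ord page)"

definition dispersable :: "'a set \<Rightarrow> 'a set set \<Rightarrow> bool" where
  "dispersable V E \<longleftrightarrow> mbt V E = max_degree V E"

end

(*
  A plane drawing of a bridgeless cubic graph is built by ears: an ear drawn inside a face bounded by
  a cycle splits that cycle and, by the theta-curve theorem, its region. This shows that the faces
  are directed cycles partitioning the darts (oriented edges), and that every flow modulo 3 is the
  coboundary of a potential on the faces. A bipartite cubic graph has no bridge, and its constant
  flow from one colour class to the other yields a proper 3-colouring of the faces, hence three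
  perfect matchings m, s, t such that each face is bounded by two of them.

  The faces bounded by m and t are cycles covering all vertices. Starting with one of them, the others
  are inserted one at a time into the vertex order next to an s-edge. Every m-edge then joins
  consecutive vertices and the t-edges are nested. If two s-edges crossed, walking along the order
  between the ends of one of them would give a closed walk in the dual graph on which some flow does
  not vanish, although flows are coboundaries.
*)

theory Submission
  imports Defs
begin

section \<open>The theta curve\<close>

text \<open>Two obstacles shape the proof. The faces of an arbitrary drawing have no usable
  description at first, so they are not read off from the finished graph: cycles with regions are
  carried along while the graph grows. Every ear must have two different ends, since otherwise the
  faces would not be bounded by cycles; the absence of bridges lets an ear find its way back, and
  degree three forbids it to return to its own starting point. Secondly, the construction of the
  order controls only the \<open>m\<close>- and \<open>t\<close>-edges. The \<open>s\<close>-edges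
  are mastered indirectly, by letting neighbours in the order always share a face.

  The integers modulo 3, which are the type \<open>3\<close>, serve two ends. Three equal values
  leave each vertex of one class, and 3 = 0 makes this a flow, whose potential changes by one across
  each edge and so colours the faces properly. And 2 is invertible, so that a sum which equals its
  own negative vanishes; this disposes of the \<open>s\<close>-edges with both ends in the interval
  considered at the end.\<close>

lemma Jordan_two_arcs:
  fixes c1 c2 :: "real \<Rightarrow> complex"
  assumes "arc c1" "arc c2" and e: "pathstart c1 = a" "pathfinish c1 = b" "pathstart c2 = a" "pathfinish c2 = b"
    and i: "path_image c1 \<inter> path_image c2 = {a, b}"
  defines "K \<equiv> path_image c1 \<union> path_image c2"
  shows "components (- K) = {inside K, outside K}"
    and "inside K \<noteq> {}" "outside K \<noteq> {}" "connected (inside K)" "connected (outside K)"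
    and "frontier (inside K) = K" "frontier (outside K) = K" "compact K" "open (inside K)" "open (outside K)"
proof -
  let ?c = "c1 +++ reversepath c2"
  have sp: "simple_path ?c"
    using assms by (intro simple_path_join_loop) (auto simp: arc_reversepath)
  have K: "path_image ?c = K"
    using e by (simp add: K_def path_image_join)
  have loop: "pathfinish ?c = pathstart ?c" using e by simp
  note J = Jordan_inside_outside[OF sp loop, unfolded K]
  show "inside K \<noteq> {}" "outside K \<noteq> {}" "connected (inside K)" "connected (outside K)"
    "frontier (inside K) = K" "frontier (outside K) = K" "open (inside K)" "open (outside K)" using J by auto
  show "compact K" using K sp compact_path_image simple_path_imp_path by metis
  have "components (\<Union>{inside K, outside K}) = {inside K, outside K}"
    using J by (intro components_open_unique) (auto simp: pairwise_def disjnt_def Int_commute)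
  then show "components (- K) = {inside K, outside K}" using J by simp
qed

lemma theta_split_inside:
  fixes c1 c2 c :: "real \<Rightarrow> complex"
  assumes arcs: "arc c1" "arc c2" "arc c"
    and e: "pathstart c1 = a" "pathfinish c1 = b" "pathstart c2 = a" "pathfinish c2 = b" "pathstart c = a" "pathfinish c = b"
    and i: "path_image c1 \<inter> path_image c2 = {a, b}" "path_image c1 \<inter> path_image c = {a, b}" "path_image c2 \<inter> path_image c = {a, b}"
    and ne: "path_image c \<inter> inside (path_image c1 \<union> path_image c2) \<noteq> {}"
  shows "inside (path_image c1 \<union> path_image c) \<inter> inside (path_image c2 \<union> path_image c) = {}"
    "inside (path_image c1 \<union> path_image c) \<union> inside (path_image c2 \<union> path_image c) \<union> (path_image c - {a,b})
      = inside (path_image c1 \<union> path_image c2)"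
proof -
  have "a \<noteq> b" using arcs(1) e arc_distinct_ends by metis
  from split_inside_simple_closed_curve[OF arc_imp_simple_path[OF arcs(1)] e(1,2) arc_imp_simple_path[OF arcs(2)] e(3,4)
      arc_imp_simple_path[OF arcs(3)] e(5,6) this i ne]
  show "inside (path_image c1 \<union> path_image c) \<inter> inside (path_image c2 \<union> path_image c) = {}"
    "inside (path_image c1 \<union> path_image c) \<union> inside (path_image c2 \<union> path_image c) \<union> (path_image c - {a,b})
      = inside (path_image c1 \<union> path_image c2)" by auto
qed

lemma arc_interior_connected:
  fixes c :: "real \<Rightarrow> complex"
  assumes "arc c"
  shows "connected (path_image c - {pathstart c, pathfinish c})" "path_image c - {pathstart c, pathfinish c} \<noteq> {}"
  using connected_simple_path_endless nonempty_simple_path_endless arc_imp_simple_path[OF assms] by blast+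

text \<open>Set algebra behind the unbounded case. If \<open>C1\<close> is the middle one of three
  arcs, it splits the inside of \<open>C2 \<union> C\<close>; complementing that partition shows how
  \<open>C\<close> splits the outside of \<open>C1 \<union> C2\<close>. The set \<open>P\<close>
  holds the common ends.\<close>

lemma inside_split_outside:
  fixes C1 C2 C P :: "complex set"
  assumes "inside (C2 \<union> C1) \<inter> inside (C \<union> C1) = {}"
    "inside (C2 \<union> C1) \<union> inside (C \<union> C1) \<union> (C1 - P) = inside (C2 \<union> C)"
    "P \<subseteq> C" "C1 \<inter> C = P" "C2 \<inter> C = P" "C1 \<inter> C2 = P"
    "(C - P) \<subseteq> outside (C1 \<union> C2)"
  shows "inside (C1 \<union> C) \<inter> outside (C2 \<union> C) = {}"
    "inside (C1 \<union> C) \<union> outside (C2 \<union> C) \<union> (C - P) = outside (C1 \<union> C2)"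
proof -
  have o: "outside K = - K - inside K" for K :: "complex set"
    using inside_Un_outside[of K] inside_Int_outside[of K] by blast
  have ni: "inside K \<inter> K = {}" for K :: "complex set" by (simp add: inside_no_overlap)
  have eqs: "C2 \<union> C1 = C1 \<union> C2" "C \<union> C1 = C1 \<union> C" by auto
  show "inside (C1 \<union> C) \<inter> outside (C2 \<union> C) = {}"
    using assms(2)[unfolded eqs] inside_Int_outside[of "C2 \<union> C"] by blast
  have d: "inside (C1 \<union> C) \<inter> inside (C1 \<union> C2) = {}" using assms(1) eqs by (simp add: Int_commute)
  show "inside (C1 \<union> C) \<union> outside (C2 \<union> C) \<union> (C - P) = outside (C1 \<union> C2)"
  proof (rule set_eqI)
    fix x :: complex
    \<comment> \<open>Membership of one point in each set becomes a propositional variable, and the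
      identity a propositional consequence of the assumptions.\<close>
    let ?m = "\<lambda>A :: complex set. x \<in> A"
    have 1: "?m (inside (C1 \<union> C2)) \<or> ?m (inside (C1 \<union> C)) \<or> (?m C1 \<and> \<not> ?m P) \<longleftrightarrow> ?m (inside (C2 \<union> C))"
      unfolding assms(2)[symmetric, unfolded eqs] by simp
    have 2: "?m P \<Longrightarrow> ?m C" "?m P \<Longrightarrow> ?m C1" "?m P \<Longrightarrow> ?m C2" "?m C1 \<Longrightarrow> ?m C \<Longrightarrow> ?m P"
      "?m C2 \<Longrightarrow> ?m C \<Longrightarrow> ?m P" "?m C1 \<Longrightarrow> ?m C2 \<Longrightarrow> ?m P"
      "?m C \<Longrightarrow> \<not> ?m P \<Longrightarrow> \<not> ?m (inside (C1 \<union> C2))"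
      using assms(3-7) unfolding o[of "C1 \<union> C2"] by blast+
    have 3: "\<not> (?m (inside (C1 \<union> C)) \<and> ?m (inside (C1 \<union> C2)))" using d by blast
    have 4: "?m (inside (C1 \<union> C)) \<Longrightarrow> \<not> ?m C1 \<and> \<not> ?m C" "?m (inside (C2 \<union> C)) \<Longrightarrow> \<not> ?m C2 \<and> \<not> ?m C"
      "?m (inside (C1 \<union> C2)) \<Longrightarrow> \<not> ?m C1 \<and> \<not> ?m C2" using ni[of "C1 \<union> C"] ni[of "C2 \<union> C"] ni[of "C1 \<union> C2"] by blast+
    show "?m (inside (C1 \<union> C) \<union> outside (C2 \<union> C) \<union> (C - P)) \<longleftrightarrow> ?m (outside (C1 \<union> C2))"
      unfolding o Un_iff Diff_iff Compl_iff using 1 2 3 4 by argo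
  qed
qed

text \<open>One of the two old arcs must be the middle one. Otherwise the inside of each of the
  three curves misses the third arc. Then a point x inside the curve of \<open>c2\<close> and
  \<open>c\<close> and a point y outside everything are separated neither by \<open>c1\<close> with
  \<open>c\<close> nor by \<open>c1\<close> with \<open>c2\<close>. These two curves meet in the
  connected set \<open>c1\<close>, so Janiszewski's theorem joins x to y off all three arcs,
  although \<open>c2\<close> with \<open>c\<close> separates them.\<close>

lemma theta_outside:
  fixes c1 c2 c :: "real \<Rightarrow> complex"
  assumes arcs: "arc c1" "arc c2" "arc c"
    and e: "pathstart c1 = a" "pathfinish c1 = b" "pathstart c2 = a" "pathfinish c2 = b" "pathstart c = a" "pathfinish c = b"
    and i: "path_image c1 \<inter> path_image c2 = {a, b}" "path_image c1 \<inter> path_image c = {a, b}" "path_image c2 \<inter> path_image c = {a, b}"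
    and out: "path_image c - {a, b} \<subseteq> outside (path_image c1 \<union> path_image c2)"
  shows "path_image c1 \<inter> inside (path_image c2 \<union> path_image c) \<noteq> {} \<or>
    path_image c2 \<inter> inside (path_image c1 \<union> path_image c) \<noteq> {}"
proof (rule ccontr)
  assume "\<not> ?thesis"
  then have n1: "path_image c1 \<inter> inside (path_image c2 \<union> path_image c) = {}"
    and n2: "path_image c2 \<inter> inside (path_image c1 \<union> path_image c) = {}" by auto
  let ?K = "path_image c1 \<union> path_image c2 \<union> path_image c"
  note J12 = Jordan_two_arcs[OF arcs(1,2) e(1-4) i(1)]
  note J1 = Jordan_two_arcs[OF arcs(1,3) e(1,2) e(5,6) i(2)]
  note J2 = Jordan_two_arcs[OF arcs(2,3) e(3-6) i(3)]
  let ?I1 = "inside (path_image c1 \<union> path_image c)"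
  let ?I2 = "inside (path_image c2 \<union> path_image c)"
  let ?I = "inside (path_image c1 \<union> path_image c2)"
  have ab: "a \<in> path_image c1" "a \<in> path_image c2" "b \<in> path_image c1" "b \<in> path_image c2"
     using e by (metis pathstart_in_path_image pathfinish_in_path_image)+
  have cK: "closed ?K" "bounded ?K"
    using arcs arc_imp_path by (auto intro!: closed_Un compact_imp_closed compact_path_image compact_imp_bounded)
  have c_I: "path_image c \<inter> ?I = {}"
    using out inside_Int_outside[of "path_image c1 \<union> path_image c2"] ab inside_no_overlap[of "path_image c1 \<union> path_image c2"] by blast
  \<comment> \<open>A component of the complement of one curve that misses the third arc is still a
    component of the complement of all three, so two such insides are equal or disjoint.\<close>
  have co: "?I1 \<in> components (- ?K)" "?I2 \<in> components (- ?K)" "?I \<in> components (- ?K)"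
  proof -
    have *: "A \<in> components (- ?K)" if "A \<in> components (- L)" "L \<subseteq> ?K" "A \<inter> ?K = {}" for A L
      using that components_intermediate_subset[of A "-L" "-?K"] by blast
    have ni: "inside L \<inter> L = {}" for L :: "complex set" by (rule inside_no_overlap)
    show "?I1 \<in> components (- ?K)"
      by (rule *[of _ "path_image c1 \<union> path_image c"], simp only: J1(1), blast, blast, use n2 ni in blast)
    show "?I2 \<in> components (- ?K)"
      by (rule *[of _ "path_image c2 \<union> path_image c"], simp only: J2(1), blast, blast, use n1 ni in blast)
    show "?I \<in> components (- ?K)"
      by (rule *[of _ "path_image c1 \<union> path_image c2"], simp only: J12(1), blast, blast, use c_I ni in blast)
  qed
  have ne1: "path_image c1 - {a,b} \<noteq> {}" "path_image c2 - {a,b} \<noteq> {}" using arc_interior_connected(2) arcs e by metis+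
  \<comment> \<open>Equal insides would have equal frontiers, that is, the two curves would
    coincide.\<close>
  have "?I2 \<noteq> ?I1"
  proof
    assume "?I2 = ?I1"
    then have "path_image c2 \<union> path_image c = path_image c1 \<union> path_image c" using J1(6) J2(6) by metis
    then show False using i ne1 by blast
  qed
  then have d12: "?I2 \<inter> ?I1 = {}" using co components_nonoverlap by metis
  have "?I2 \<noteq> ?I"
  proof
    assume "?I2 = ?I"
    then have "path_image c2 \<union> path_image c = path_image c1 \<union> path_image c2" using J12(6) J2(6) by metis
    then show False using i ne1 by blast
  qed
  then have d1: "?I2 \<inter> ?I = {}" using co components_nonoverlap by metis
  obtain x where x: "x \<in> ?I2" using J2(2) by blast
  have "\<exists>y. y \<in> outside ?K" using cK(2) outside_bounded_nonempty by blast
  then obtain y where y: "y \<in> outside ?K" ..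
  have xK: "x \<notin> ?K" using co(2) x in_components_subset by blast
  have yo: "y \<in> outside L" if "L \<subseteq> ?K" for L using y outside_mono[OF that] by blast
  have xo: "x \<in> outside (path_image c1 \<union> path_image c)" "x \<in> outside (path_image c1 \<union> path_image c2)"
    using x d12 d1 xK unfolding outside_inside by auto
  have "connected_component (- (path_image c1 \<union> path_image c)) x y"
    using J1(5) xo yo unfolding connected_component_def
    by (metis Un_assoc Un_upper1 Un_upper2 outside_no_overlap sup_commute disjoint_eq_subset_Compl)
  moreover have "connected_component (- (path_image c1 \<union> path_image c2)) x y"
    using J12(5) xo yo unfolding connected_component_def
    by (metis Un_upper1 outside_no_overlap disjoint_eq_subset_Compl)
  moreover have "(path_image c1 \<union> path_image c) \<inter> (path_image c1 \<union> path_image c2) = path_image c1"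
    using i ab by auto
  ultimately have "connected_component (- ((path_image c1 \<union> path_image c) \<union> (path_image c1 \<union> path_image c2))) x y"
    by (intro Janiszewski[OF J1(8) compact_imp_closed[OF J12(8)]]) (simp_all add: arcs connected_arc_image)
  then have "connected_component (- ?K) x y" by (simp add: Un_ac)
  then have "connected_component (- (path_image c2 \<union> path_image c)) x y"
    by (rule connected_component_of_subset) auto
  then have "y \<in> ?I2" using x inside_same_component by metis
  then show False using yo[of "path_image c2 \<union> path_image c"] inside_Int_outside by blast
qed

text \<open>\<open>R\<close> may be the unbounded side, since the outer face is treated like all
  others. In that case \<open>c1\<close> or \<open>c2\<close> is the middle arc, and the bounded
  case is applied with the arcs permuted: the new region next to the middle arc is bounded, the
  other one stays unbounded.\<close>

theorem theta_split:
  fixes c1 c2 c :: "real \<Rightarrow> complex"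
  assumes arcs: "arc c1" "arc c2" "arc c"
    and e: "pathstart c1 = a" "pathfinish c1 = b" "pathstart c2 = a" "pathfinish c2 = b" "pathstart c = a" "pathfinish c = b"
    and i: "path_image c1 \<inter> path_image c2 = {a, b}" "path_image c1 \<inter> path_image c = {a, b}" "path_image c2 \<inter> path_image c = {a, b}"
    and R: "R \<in> components (- (path_image c1 \<union> path_image c2))" "path_image c - {a, b} \<subseteq> R"
  obtains R1 R2 where "R1 \<in> components (- (path_image c1 \<union> path_image c))" "R2 \<in> components (- (path_image c2 \<union> path_image c))"
    "R1 \<inter> R2 = {}" "R1 \<union> R2 \<union> (path_image c - {a, b}) = R"
proof -
  let ?C1 = "path_image c1" and ?C2 = "path_image c2" and ?C = "path_image c"
  note J12 = Jordan_two_arcs[OF arcs(1,2) e(1-4) i(1)]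
  note J1 = Jordan_two_arcs[OF arcs(1,3) e(1,2) e(5,6) i(2)]
  note J2 = Jordan_two_arcs[OF arcs(2,3) e(3-6) i(3)]
  have ne: "?C - {a,b} \<noteq> {}" using arc_interior_connected(2) arcs(3) e by metis
  have ab: "{a, b} \<subseteq> ?C" using e by (metis empty_subsetI insert_subset pathstart_in_path_image pathfinish_in_path_image)
  consider "R = inside (?C1 \<union> ?C2)" | "R = outside (?C1 \<union> ?C2)" using R J12(1) by auto
  then show thesis
  proof cases
    case 1
    then have "?C \<inter> inside (?C1 \<union> ?C2) \<noteq> {}" using R ne by blast
    from theta_split_inside[OF arcs e i this] show ?thesis
      using that[of "inside (?C1 \<union> ?C)" "inside (?C2 \<union> ?C)"] J1(1) J2(1) 1 by auto
  next
    case 2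
    have out: "?C - {a, b} \<subseteq> outside (?C1 \<union> ?C2)" using R 2 by simp
    have i': "?C2 \<inter> ?C1 = {a,b}" "?C \<inter> ?C1 = {a,b}" "?C \<inter> ?C2 = {a,b}" using i by auto
    have "?C1 \<inter> inside (?C2 \<union> ?C) \<noteq> {} \<or> ?C2 \<inter> inside (?C1 \<union> ?C) \<noteq> {}"
      using theta_outside[OF arcs e i out] .
    then show ?thesis
    proof
      assume n: "?C1 \<inter> inside (?C2 \<union> ?C) \<noteq> {}"
      have "inside (?C1 \<union> ?C) \<inter> outside (?C2 \<union> ?C) = {}"
        "inside (?C1 \<union> ?C) \<union> outside (?C2 \<union> ?C) \<union> (?C - {a, b}) = outside (?C1 \<union> ?C2)"
        using theta_split_inside[OF arcs(2,3,1) e(3-6) e(1,2) i(3) i'(1,2) n]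
        by (intro inside_split_outside; use ab i out in blast)+
      then show ?thesis
        using that[of "inside (?C1 \<union> ?C)" "outside (?C2 \<union> ?C)"] J1(1) J2(1) 2 by auto
    next
      assume n: "?C2 \<inter> inside (?C1 \<union> ?C) \<noteq> {}"
      have out': "?C - {a, b} \<subseteq> outside (?C2 \<union> ?C1)" using out by (simp add: Un_commute)
      have "inside (?C2 \<union> ?C) \<inter> outside (?C1 \<union> ?C) = {}"
        "inside (?C2 \<union> ?C) \<union> outside (?C1 \<union> ?C) \<union> (?C - {a, b}) = outside (?C2 \<union> ?C1)"
        using theta_split_inside[OF arcs(1,3,2) e(1,2) e(5,6) e(3,4) i(2) i(1) i'(3) n]
        by (intro inside_split_outside; use ab i out' in blast)+
      then show ?thesis
        using that[of "outside (?C1 \<union> ?C)" "inside (?C2 \<union> ?C)"] J1(1) J2(1) 2 by (auto simp: Un_commute)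
    qed
  qed
qed

section \<open>Faces as cycles of darts\<close>

fun darts :: "'a list \<Rightarrow> ('a \<times> 'a) set" where
  "darts (x # y # zs) = insert (x, y) (darts (y # zs))"
| "darts _ = {}"

lemma darts_append: "darts (xs @ a # ys) = darts (xs @ [a]) \<union> darts (a # ys)"
  by (induction xs rule: darts.induct) auto

lemma darts_rev: "darts (rev xs) = (darts xs)\<inverse>"
proof (induction xs rule: darts.induct)
  case (1 x y zs)
  have "darts (rev (x # y # zs)) = darts (rev (y # zs)) \<union> {(y, x)}"
    using darts_append[of "rev zs" y "[x]"] by simp
  then show ?case using 1 by auto
qed auto

lemma darts_in_set: "(u, v) \<in> darts xs \<Longrightarrow> u \<in> set (butlast xs) \<and> v \<in> set (tl xs)"
  by (induction xs rule: darts.induct) auto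

lemma darts_in_set': "(u, v) \<in> darts xs \<Longrightarrow> u \<in> set xs \<and> v \<in> set xs"
  by (induction xs rule: darts.induct) auto

lemma fst_darts: "fst ` darts (xs @ [x]) = set xs"
proof (induction xs)
  case (Cons a xs)
  then show ?case by (cases xs) auto
qed auto

lemma snd_darts: "snd ` darts (x # xs) = set xs"
  by (induction xs arbitrary: x) auto

lemma darts_distinct_antisym:
  "distinct xs \<Longrightarrow> (u, v) \<in> darts xs \<Longrightarrow> (v, u) \<notin> darts xs"
  by (induction xs rule: darts.induct) (auto dest: darts_in_set')

text \<open>As a set of darts a cycle forgets its starting vertex. At least three vertices are
  demanded, so that no cycle contains a dart together with its reverse.\<close>

definition dcycle :: "('a \<times> 'a) set \<Rightarrow> bool" where
  "dcycle D \<longleftrightarrow> (\<exists>x ys. distinct (x # ys) \<and> 2 \<le> length ys \<and> D = darts (x # ys @ [x]))"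

lemma dcycleI: "distinct (x # ys) \<Longrightarrow> 2 \<le> length ys \<Longrightarrow> dcycle (darts (x # ys @ [x]))"
  unfolding dcycle_def by blast

lemma dcycle_rotate:
  assumes "dcycle D" "a \<in> fst ` D"
  obtains ys where "distinct (a # ys)" "2 \<le> length ys" "D = darts (a # ys @ [a])"
proof -
  obtain x ys where x: "distinct (x # ys)" "2 \<le> length ys" and D: "D = darts (x # ys @ [x])"
    using assms(1) unfolding dcycle_def by blast
  have "a \<in> set (x # ys)" using assms(2) D fst_darts[of "x # ys" x] by simp
  then obtain us vs where uv: "x # ys = us @ a # vs" by (meson split_list)
  show ?thesis
  proof (cases us)
    case Nil
    then show ?thesis using that[of ys] x D uv by simp
  next
    case (Cons u us')
    then have ys: "ys = us' @ a # vs" "u = x" using uv by auto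
    have "D = darts (x # us' @ [a]) \<union> darts (a # vs @ [x])"
      using D darts_append[of "x # us'" a "vs @ [x]"] ys by simp
    also have "\<dots> = darts (a # (vs @ x # us') @ [a])"
      using darts_append[of "a # vs" x "us' @ [a]"] by auto
    finally show ?thesis using that[of "vs @ x # us'"] x ys by auto
  qed
qed

text \<open>The ends of an ear cut a face cycle into two paths; \<open>dcycle_join\<close> closes
  each of them with the ear.\<close>

lemma dcycle_split:
  assumes "dcycle D" "a \<in> fst ` D" "b \<in> fst ` D" "a \<noteq> b"
  obtains ps qs where "distinct (a # ps @ b # qs)" "D = darts (a # ps @ [b]) \<union> darts (b # qs @ [a])"
proof -
  obtain ys where ys: "distinct (a # ys)" "2 \<le> length ys" "D = darts (a # ys @ [a])"
    using dcycle_rotate[OF assms(1,2)] .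
  have "b \<in> set ys" using assms(3,4) ys fst_darts[of "a # ys" a] by auto
  then obtain ps qs where "ys = ps @ b # qs" by (meson split_list)
  then show ?thesis using that[of ps qs] ys darts_append[of "a # ps" b "qs @ [a]"] by auto
qed

lemma darts_split_disjoint:
  assumes "distinct (a # ps @ b # qs)"
  shows "darts (a # ps @ [b]) \<inter> darts (b # qs @ [a]) = {}"
proof -
  have "u \<in> set (a # ps) \<and> u \<in> set (b # qs)" if "(u, v) \<in> darts (a # ps @ [b])" "(u, v) \<in> darts (b # qs @ [a])" for u v
    using darts_in_set[OF that(1)] darts_in_set[OF that(2)] by (auto simp: butlast_append split: if_splits)
  then show ?thesis using assms by auto
qed

lemma dcycle_join:
  assumes "distinct (a # ps @ b # qs)" "length ps + length qs > 0"
  shows "dcycle (darts (a # ps @ [b]) \<union> darts (b # qs @ [a]))"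
  using dcycleI[of a "ps @ b # qs"] assms darts_append[of "a # ps" b "qs @ [a]"] by auto

lemma dcycle_at:
  assumes "dcycle D" "a \<in> fst ` D"
  obtains y z where "y \<noteq> z" "y \<noteq> a" "z \<noteq> a" "\<And>w. (a, w) \<in> D \<longleftrightarrow> w = y" "\<And>w. (w, a) \<in> D \<longleftrightarrow> w = z"
proof -
  obtain ys where ys: "distinct (a # ys)" "2 \<le> length ys" and D: "D = darts (a # ys @ [a])"
    using dcycle_rotate[OF assms] .
  obtain y us where y: "ys = y # us" using ys(2) by (cases ys) auto
  obtain vs z where z: "ys = vs @ [z]" using ys(2) by (cases ys rule: rev_cases) auto
  have out: "(a, w) \<in> D \<longleftrightarrow> w = y" for w
    using D y ys(1) darts_in_set[of a w "y # us @ [a]"] by (auto simp: butlast_append split: if_splits)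
  have "D = darts (a # vs @ [z]) \<union> {(z, a)}" using D z darts_append[of "a # vs" z "[a]"] by simp
  then have inn: "(w, a) \<in> D \<longleftrightarrow> w = z" for w
    using z ys(1) darts_in_set[of w a "a # vs @ [z]"] by auto
  have "us \<noteq> []" using y ys(2) by auto
  then have "last us = z" using y z by (metis last_ConsR last_snoc)
  then have "y \<noteq> z" using ys(1) y \<open>us \<noteq> []\<close> by auto
  moreover have "y \<in> set ys" "z \<in> set ys" by (simp add: y, simp add: z)
  then have "y \<noteq> a" "z \<noteq> a" using ys by auto
  ultimately show ?thesis using that out inn by blast
qed

lemma dcycle_snd: "dcycle D \<Longrightarrow> snd ` D = fst ` D"
proof -
  assume "dcycle D"
  then obtain x ys where D: "D = darts (x # ys @ [x])" unfolding dcycle_def by blast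
  show ?thesis using snd_darts[of x "ys @ [x]"] fst_darts[of "x # ys" x] D by simp
qed

lemma dcycle_antisym: "dcycle D \<Longrightarrow> (u, v) \<in> D \<Longrightarrow> (v, u) \<notin> D"
  by (metis dcycle_at fst_conv image_eqI)

lemma dcycle_next:
  assumes "dcycle D" "(u, v) \<in> D"
  obtains w where "(v, w) \<in> D" "w \<noteq> u"
proof -
  have "v \<in> fst ` D" using assms dcycle_snd[OF assms(1)] by (metis image_eqI snd_conv)
  then show ?thesis using dcycle_at[OF assms(1)] assms(2) that by metis
qed

lemma dcycle_converse:
  assumes "dcycle D" shows "dcycle (D\<inverse>)"
proof -
  obtain x ys where "distinct (x # ys)" "2 \<le> length ys" "D = darts (x # ys @ [x])"
    using assms unfolding dcycle_def by blast
  then show ?thesis using dcycleI[of x "rev ys"] darts_rev[of "x # ys @ [x]"] by simp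
qed

section \<open>Flows: the cycle space of a graph with coefficients in a ring\<close>

definition flow :: "'a set \<Rightarrow> ('a \<times> 'a) set \<Rightarrow> ('a \<Rightarrow> 'a \<Rightarrow> 'g::comm_ring_1) \<Rightarrow> bool" where
  "flow V S f \<longleftrightarrow> (\<forall>u v. f v u = - f u v) \<and> (\<forall>u v. (u, v) \<notin> S \<longrightarrow> f u v = 0) \<and> (\<forall>v. (\<Sum>u\<in>V. f v u) = 0)"

lemma flowD:
  assumes "flow V S f"
  shows "f v u = - f u v" "(u, v) \<notin> S \<Longrightarrow> f u v = 0" "(\<Sum>u\<in>V. f v u) = 0"
  by (rule assms[unfolded flow_def, THEN conjunct1, rule_format],
      erule assms[unfolded flow_def, THEN conjunct2, THEN conjunct1, rule_format],
      rule assms[unfolded flow_def, THEN conjunct2, THEN conjunct2, rule_format])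

definition circulation :: "('a \<times> 'a) set \<Rightarrow> 'a \<Rightarrow> 'a \<Rightarrow> 'g::comm_ring_1" where
  "circulation D u v = of_bool ((u, v) \<in> D) - of_bool ((v, u) \<in> D)"

lemma flow_circulation:
  assumes "dcycle D" "D \<subseteq> S" "sym S" "S \<subseteq> V \<times> V" "finite V"
  shows "flow V S (circulation D)"
proof -
  have "(\<Sum>u\<in>V. circulation D v u) = (0::'b)" for v
  proof (cases "v \<in> fst ` D")
    case True
    then obtain y z where yz: "y \<noteq> z" "\<And>w. (v, w) \<in> D \<longleftrightarrow> w = y" "\<And>w. (w, v) \<in> D \<longleftrightarrow> w = z"
      using dcycle_at[OF assms(1)] by metis
    then have "y \<in> V" "z \<in> V" using assms(2,4) by blast+
    then show ?thesis using assms(5) yz by (simp add: circulation_def sum_subtractf of_bool_def sum.delta)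
  next
    case False
    then have "v \<notin> snd ` D" using dcycle_snd[OF assms(1)] by simp
    then have "circulation D v u = (0::'b)" for u
      using False unfolding circulation_def by (auto simp: image_iff)
    then show ?thesis by simp
  qed
  then show ?thesis
    using assms(2,3) unfolding flow_def circulation_def sym_def by (auto simp: subset_iff)
qed

lemma flow_diff_scaled:
  assumes "flow V S f" "flow V S g"
  shows "flow V S (\<lambda>u v. f u v - k * g u v)"
proof -
  note f = flowD[OF assms(1)] and g = flowD[OF assms(2)]
  have 1: "f v u - k * g v u = - (f u v - k * g u v)" for u v
    by (subst f(1), subst g(1)) (simp add: algebra_simps)
  have 2: "(\<Sum>u\<in>V. f v u - k * g v u) = 0" for v
    by (simp add: sum_subtractf f(3) g(3) flip: sum_distrib_left)
  have 3: "f u v - k * g u v = 0" if "(u, v) \<notin> S" for u v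
    by (simp add: f(2)[OF that] g(2)[OF that])
  show ?thesis
    unfolding flow_def by (intro conjI allI impI) (rule 1, erule 3, rule 2)
qed

text \<open>Kirchhoff's law at an inner vertex, where the flow can use only the two edges of the
  path, hands the value zero from each dart to the next.\<close>

lemma flow_zero_along_path:
  assumes "flow V S f" "finite V"
    and "\<And>us x y z vs w. r = us @ x # y # z # vs \<Longrightarrow> (y, w) \<in> S \<Longrightarrow> w = x \<or> w = z"
    and "f (r ! 0) (r ! 1) = 0" "set r \<subseteq> V" "(u, v) \<in> darts r"
  shows "f u v = 0"
  using assms(3-)
proof (induction r rule: darts.induct)
  case (1 x y zs)
  have xy: "f x y = 0" using 1 by simp
  show ?case
  proof (cases "(u, v) = (x, y)")
    case False
    then have uv: "(u, v) \<in> darts (y # zs)" using 1(5) by auto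
    then obtain z vs where zs: "zs = z # vs" by (cases zs) auto
    have "f y w = 0" if "w \<noteq> z" for w
    proof (cases "(y, w) \<in> S")
      case True
      then have "w = x" using 1(2)[of "[]" x y z vs w] zs that by auto
      then show ?thesis using xy assms(1) unfolding flow_def by (metis neg_0_equal_iff_equal)
    next
      case False
      then show ?thesis using assms(1) unfolding flow_def by blast
    qed
    moreover have "z \<in> V" using 1 zs by auto
    ultimately have "(\<Sum>w\<in>V. f y w) = f y z"
      using assms(2) by (simp add: sum.remove[of V z])
    then have "f y z = 0" using assms(1) unfolding flow_def by metis
    then show ?thesis
      using 1(1)[OF _ _ _ uv] 1(2)[of "x # _"] 1(4) zs by auto
  qed (use xy in simp)
qed auto

text \<open>The last clause is exactness, the form in which planarity is used later: the flow
  through a dart is the potential of its own face minus that of the face of the reverse dart. For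
  the faces of a plane graph this is the duality between cycles and cuts. It is stated as part of
  the invariant because it survives the addition of an ear.\<close>

definition face_structure :: "'a set \<Rightarrow> ('a \<times> 'a) set \<Rightarrow> ('a \<times> 'a) set set \<Rightarrow> bool" where
  "face_structure V S \<F> \<longleftrightarrow> (\<forall>D\<in>\<F>. dcycle D) \<and> \<Union>\<F> = S \<and> sym S \<and> S \<subseteq> V \<times> V \<and>
     (\<forall>D\<in>\<F>. \<forall>D'\<in>\<F>. D \<noteq> D' \<longrightarrow> D \<inter> D' = {}) \<and>
     (\<forall>f. flow V S f \<longrightarrow> (\<exists>c :: ('a \<times> 'a) set \<Rightarrow> 3. \<forall>D\<in>\<F>. \<forall>D'\<in>\<F>. \<forall>u v.
        (u, v) \<in> D \<and> (v, u) \<in> D' \<longrightarrow> f u v = c D - c D'))"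

lemma face_structureD:
  assumes "face_structure V S \<F>"
  shows "X \<in> \<F> \<Longrightarrow> dcycle X" "\<Union>\<F> = S" "sym S" "S \<subseteq> V \<times> V"
    "X \<in> \<F> \<Longrightarrow> Y \<in> \<F> \<Longrightarrow> X \<noteq> Y \<Longrightarrow> X \<inter> Y = {}"
  using assms unfolding face_structure_def by (elim conjE; simp)+

text \<open>Flows on a cycle are the multiples of its circulation, so the two faces receive the
  potentials \<open>k\<close> and 0.\<close>

lemma face_structure_dcycle:
  assumes "dcycle D" "D \<subseteq> V \<times> V" "finite V"
  shows "face_structure V (D \<union> D\<inverse>) {D, D\<inverse>}"
proof -
  let ?S = "D \<union> D\<inverse>"
  have disj: "D \<inter> D\<inverse> = {}" using dcycle_antisym[OF assms(1)] by auto
  have S: "sym ?S" "?S \<subseteq> V \<times> V" using assms(2) by (auto simp: sym_def)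
  have "\<exists>c :: ('a \<times> 'a) set \<Rightarrow> 3. \<forall>X\<in>{D, D\<inverse>}. \<forall>Y\<in>{D, D\<inverse>}. \<forall>u v.
        (u, v) \<in> X \<and> (v, u) \<in> Y \<longrightarrow> f u v = c X - c Y" if f: "flow V ?S f" for f
  proof -
    obtain x ys where ys: "distinct (x # ys)" "2 \<le> length ys" and D: "D = darts (x # ys @ [x])"
      using assms(1) unfolding dcycle_def by blast
    let ?r = "x # ys @ [x]"
    \<comment> \<open>The multiple is read off from the first dart; the difference vanishes there
      and hence along the whole cycle.\<close>
    define k where "k = f (?r ! 0) (?r ! 1)"
    let ?g = "\<lambda>u v. f u v - k * circulation D u v"
    have g: "flow V ?S ?g" using f flow_circulation[OF assms(1) _ S assms(3)] by (intro flow_diff_scaled) auto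
    have first: "(?r ! 0, ?r ! 1) \<in> D" using ys(2) D by (cases ys) auto
    have z: "?g u v = 0" if "(u, v) \<in> D" for u v
    proof (rule flow_zero_along_path[OF g assms(3)])
      show "?g (?r ! 0) (?r ! 1) = 0"
        using first dcycle_antisym[OF assms(1) first] by (simp add: k_def circulation_def)
      show "set ?r \<subseteq> V" using assms(2) D fst_darts[of "x # ys" x] by force
      show "(u, v) \<in> darts ?r" using that D by simp
      fix us a y b vs w assume r: "?r = us @ a # y # b # vs" and yw: "(y, w) \<in> ?S"
      then have "(a, y) \<in> D" "(y, b) \<in> D" using D darts_append[of us a "y # b # vs"] by auto
      then show "w = a \<or> w = b" using yw dcycle_at[OF assms(1), of y] by (metis Un_iff converseD fst_conv image_eqI)
    qed
    then have fk: "f u v = k" if "(u, v) \<in> D" for u v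
      using z[OF that] that dcycle_antisym[OF assms(1) that] by (simp add: circulation_def)
    have fk': "f u v = - k" if "(v, u) \<in> D" for u v using f fk[OF that] unfolding flow_def by metis
    have "D \<noteq> D\<inverse>" using disj first by auto
    then have "f u v = (if X = D then k else 0) - (if Y = D then k else 0)"
      if "X \<in> {D, D\<inverse>}" "Y \<in> {D, D\<inverse>}" "(u, v) \<in> X" "(v, u) \<in> Y" for X Y u v
      using that fk fk' dcycle_antisym[OF assms(1), of u v] by auto
    then show ?thesis by (intro exI[of _ "\<lambda>X. if X = D then k else 0"]) blast
  qed
  then show ?thesis
    unfolding face_structure_def using assms(1) dcycle_converse[OF assms(1)] S disj
    by (intro conjI allI impI) (blast | simp add: Int_commute)+
qed

lemma face_structure_potential:
  fixes f :: "'a \<Rightarrow> 'a \<Rightarrow> 3"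
  assumes "face_structure V S \<F>" "flow V S f"
  shows "\<exists>c. \<forall>X Y u v. X \<in> \<F> \<longrightarrow> Y \<in> \<F> \<longrightarrow> (u, v) \<in> X \<longrightarrow> (v, u) \<in> Y \<longrightarrow> f u v = c X - c Y"
proof -
  have "\<forall>f. flow V S f \<longrightarrow> (\<exists>c :: ('a \<times> 'a) set \<Rightarrow> 3. \<forall>D\<in>\<F>. \<forall>D'\<in>\<F>. \<forall>u v.
        (u, v) \<in> D \<and> (v, u) \<in> D' \<longrightarrow> f u v = c D - c D')"
    using assms(1) unfolding face_structure_def by simp
  then obtain c :: "('a \<times> 'a) set \<Rightarrow> 3" where "\<forall>D\<in>\<F>. \<forall>D'\<in>\<F>. \<forall>u v. (u, v) \<in> D \<and> (v, u) \<in> D' \<longrightarrow> f u v = c D - c D'"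
    using assms(2) by metis
  then show ?thesis by blast
qed

lemma disjoint_from_extension:
  "X \<subseteq> D \<union> Q \<Longrightarrow> Q \<inter> S = {} \<Longrightarrow> Z \<subseteq> S \<Longrightarrow> Z \<inter> D = {} \<Longrightarrow> X \<inter> Z = {}"
  by blast

lemma Int_subset_of_extension: "X \<subseteq> D \<union> Q \<Longrightarrow> Q \<inter> S = {} \<Longrightarrow> X \<inter> S \<subseteq> D"
  by blast

text \<open>Subtracting a multiple of the circulation of \<open>D2\<close> makes a flow vanish on
  the ear, whose inner vertices have degree two, and leaves a flow on the old graph. Its potential
  is kept, with \<open>D1\<close> and \<open>D2\<close> inheriting the value of \<open>D\<close>,
  and the multiple is then added on \<open>D2\<close> alone.\<close>

lemma face_structure_ear:
  assumes fs: "face_structure V S \<F>" and fin: "finite V" and D: "D \<in> \<F>" "D = darts (a # ps @ [b]) \<union> darts (b # qs @ [a])"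
    and dist: "distinct (a # ps @ b # qs)"
    and ear: "distinct (a # rs @ [b])" "set rs \<subseteq> V" "set rs \<inter> fst ` S = {}" "(a, b) \<notin> S \<or> rs \<noteq> []"
  defines "R \<equiv> darts (a # rs @ [b])"
  defines "D1 \<equiv> darts (a # ps @ [b]) \<union> R\<inverse>" and "D2 \<equiv> R \<union> darts (b # qs @ [a])"
  shows "face_structure V (S \<union> R \<union> R\<inverse>) (insert D1 (insert D2 (\<F> - {D})))"
proof -
  let ?S = "S \<union> R \<union> R\<inverse>" and ?F = "insert D1 (insert D2 (\<F> - {D}))"
  note F = face_structureD[OF fs]
  have DS: "D \<subseteq> S" using D F by blast
  have pqS: "set (a # ps) \<subseteq> fst ` S" "set (b # qs) \<subseteq> fst ` S"
    using image_mono[OF DS, of fst] fst_darts[of "a # ps" b] fst_darts[of "b # qs" a] unfolding D(2) image_Un by auto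
  then have ab: "a \<in> fst ` S" "b \<in> fst ` S" by auto
  have sym: "(v, u) \<in> S \<longleftrightarrow> (u, v) \<in> S" for u v using F(3) by (metis symD)
  have inS: "(u, v) \<in> S \<Longrightarrow> u \<notin> set rs \<and> v \<notin> set rs" for u v using ear(3) sym by force
  \<comment> \<open>Old darts avoid the inner vertices of the ear, and the only dart of the ear that
    could avoid them goes from \<open>a\<close> to \<open>b\<close>.\<close>
  have RS: "R \<inter> S = {}"
  proof (cases rs)
    case Nil
    then show ?thesis using ear by (auto simp: R_def)
  next
    case (Cons r rs')
    have "u \<in> set rs \<or> v \<in> set rs" if "(u, v) \<in> R" for u v
    proof (rule ccontr)
      assume "\<not> ?thesis"
      moreover have "u \<in> set (a # rs)" "v \<in> set (rs @ [b])" using that darts_in_set[of u v "a # rs @ [b]"]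
        unfolding R_def by (auto simp: butlast_append)
      ultimately have [simp]: "u = a" "v = b" by auto
      have "(a, b) \<in> darts (a # r # rs' @ [b])" using that Cons unfolding R_def by simp
      then have "(a, b) \<in> darts (r # rs' @ [b])" using ear(1) Cons by auto
      then show False using darts_in_set'[of a b] ear(1) Cons darts_in_set[of a b "(r # rs') @ [b]"] by (auto simp: butlast_append split: if_splits)
    qed
    then show ?thesis using inS by (metis disjoint_iff_not_equal prod.exhaust)
  qed
  have RiS: "R\<inverse> \<inter> S = {}" using RS F(3) by (auto dest: symD)
  have RR: "R \<inter> R\<inverse> = {}" using darts_distinct_antisym[OF ear(1)] unfolding R_def by auto
  have Rrev: "R\<inverse> = darts (b # rev rs @ [a])" using darts_rev[of "a # rs @ [b]"] unfolding R_def by simp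
  have Rne: "R \<noteq> {}" unfolding R_def by (cases rs) auto
  have disj: "set ps \<inter> set rs = {}" "set qs \<inter> set rs = {}" "a \<notin> set rs" "b \<notin> set rs"
    using pqS ear(3) by auto
  \<comment> \<open>With no inner vertex on either path \<open>D1\<close> would consist of two
    opposite darts. This cannot happen, since a chord is not parallel to an edge of
    \<open>D\<close>.\<close>
  have l1: "length ps + length rs > 0"
  proof (rule ccontr)
    assume "\<not> ?thesis" then have "(a, b) \<in> R" "(a, b) \<in> D" using D(2) unfolding R_def by auto
    then show False using RS DS by auto
  qed
  have l2: "length rs + length qs > 0"
  proof (rule ccontr)
    assume "\<not> ?thesis" then have "(a, b) \<in> R" "(b, a) \<in> D" using D(2) unfolding R_def by auto
    then show False using RS DS F(3) by (auto dest: symD)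
  qed
  have c1: "dcycle D1" unfolding D1_def Rrev
    using dist disj ear(1) l1 by (intro dcycle_join) auto
  have c2: "dcycle D2" unfolding D2_def R_def
    using dist disj ear(1) l2 by (intro dcycle_join) auto
  have pq: "darts (a # ps @ [b]) \<inter> darts (b # qs @ [a]) = {}" by (rule darts_split_disjoint[OF dist])
  have D12: "D1 \<inter> D2 = {}" using pq RS RiS RR DS unfolding D1_def D2_def D(2) by blast
  have S': "sym ?S" "?S \<subseteq> V \<times> V"
  proof -
    show "sym ?S" using F(3) by (auto simp: sym_def)
    have "set (a # rs @ [b]) \<subseteq> V" using ab F(4) ear(2) by auto
    then have "(u, v) \<in> V \<times> V" if "(u, v) \<in> R" for u v using darts_in_set'[OF that[unfolded R_def]] by blast
    then have "R \<subseteq> V \<times> V" by (rule subrelI)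
    then show "?S \<subseteq> V \<times> V" using F(4) by blast
  qed
  have disjF: "X \<inter> Y = {}" if XY: "X \<in> ?F" "Y \<in> ?F" "X \<noteq> Y" for X Y
  proof -
    have *: "D1 \<inter> Z = {}" "D2 \<inter> Z = {}" if "Z \<in> \<F> - {D}" for Z
    proof -
      have Z: "Z \<subseteq> S" "Z \<inter> D = {}" using that F(5)[of Z D] D(1) F(2) by auto
      have "D1 \<subseteq> D \<union> R\<inverse>" "D2 \<subseteq> D \<union> R" unfolding D(2) D1_def D2_def by (simp_all add: le_supI1 le_supI2)
      then show "D1 \<inter> Z = {}" "D2 \<inter> Z = {}"
        using disjoint_from_extension[OF _ RiS Z] disjoint_from_extension[OF _ RS Z] by simp_all
    qed
    consider "X \<in> {D1, D2}" "Y \<in> {D1, D2}" | "X \<in> {D1, D2}" "Y \<in> \<F> - {D}"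
      | "X \<in> \<F> - {D}" "Y \<in> {D1, D2}" | "X \<in> \<F> - {D}" "Y \<in> \<F> - {D}"
      using XY(1,2) unfolding insert_iff empty_iff by argo
    then show ?thesis
    proof cases
      case 1
      then show ?thesis using D12 \<open>X \<noteq> Y\<close> by (auto simp: Int_commute)
    next
      case 2
      then show ?thesis using *[OF 2(2)] by (elim insertE) simp_all
    next
      case 3
      then show ?thesis using *[OF 3(1)] by (elim insertE) (simp_all add: Int_commute)
    next
      case 4
      then show ?thesis using F(5)[of X Y] \<open>X \<noteq> Y\<close> by simp
    qed
  qed
  have UF: "\<Union>?F = ?S"
  proof -
    have "\<Union>?F = D1 \<union> D2 \<union> \<Union>(\<F> - {D})" by auto
    also have "\<dots> = D \<union> R \<union> R\<inverse> \<union> \<Union>(\<F> - {D})" unfolding D1_def D2_def D(2) by (simp only: Un_ac)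
    also have "\<dots> = ?S" using F(2) D(1) by auto
    finally show ?thesis .
  qed
  have pot: "\<exists>c :: ('a \<times> 'a) set \<Rightarrow> 3. \<forall>X\<in>?F. \<forall>Y\<in>?F. \<forall>u v. (u, v) \<in> X \<and> (v, u) \<in> Y \<longrightarrow> f u v = c X - c Y"
    if f: "flow V ?S f" for f
  proof -
    let ?r = "a # rs @ [b]"
    define k where "k = f (?r ! 0) (?r ! 1)"
    define g where "g = (\<lambda>u v. f u v - k * circulation D2 u v)"
    have g: "flow V ?S g" unfolding g_def
      using f flow_circulation[OF c2 _ S' fin] UF by (intro flow_diff_scaled) auto
    have first: "(?r ! 0, ?r ! 1) \<in> R" unfolding R_def by (cases rs) auto
    have RD2: "R \<subseteq> D2" unfolding D2_def by auto
    have z: "g u v = 0" if "(u, v) \<in> R" for u v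
    proof (rule flow_zero_along_path[OF g fin])
      show "g (?r ! 0) (?r ! 1) = 0"
        using first RD2 dcycle_antisym[OF c2, of "?r ! 0" "?r ! 1"] by (auto simp: k_def g_def circulation_def)
      show "set ?r \<subseteq> V" using ab F(4) ear(2) by auto
      show "(u, v) \<in> darts ?r" using that R_def by simp
      fix us x y z vs w assume r: "?r = us @ x # y # z # vs" and yw: "(y, w) \<in> ?S"
      have "y \<in> set rs"
      proof -
        have "rs @ [b] = tl (us @ [x]) @ y # z # vs" using r by (cases us) auto
        then have "rs = tl (us @ [x]) @ y # butlast (z # vs)" by (metis butlast_snoc butlast_append list.distinct(1) butlast.simps(2))
        then show ?thesis by auto
      qed
      then have "(y, w) \<notin> S" using inS by blast
      then have "(y, w) \<in> R \<or> (w, y) \<in> R" using yw by auto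
      then have "(y, w) \<in> D2 \<or> (w, y) \<in> D2" using RD2 by auto
      moreover have "(x, y) \<in> D2" "(y, z) \<in> D2" using RD2 r darts_append[of us x "y # z # vs"] unfolding R_def by auto
      ultimately show "w = x \<or> w = z" using dcycle_at[OF c2, of y] by (metis fst_conv image_eqI)
    qed
    have ganti: "g v u = - g u v" for u v using g unfolding flow_def by blast
    have g0: "g u v = 0" if uv: "(u, v) \<notin> S" for u v
    proof -
      consider "(u, v) \<in> R" | "(v, u) \<in> R" | "(u, v) \<notin> ?S" using uv by auto
      then show ?thesis
      proof cases
        case 2
        then show ?thesis using z[of v u] ganti[of v u] by simp
      qed (use z g[unfolded flow_def] in blast)+
    qed
    have "flow V S g"
      unfolding flow_def
    proof (intro conjI allI impI)
      show "(\<Sum>u\<in>V. g v u) = 0" for v using g unfolding flow_def by blast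
    qed (rule ganti, rule g0)
    then obtain c :: "('a \<times> 'a) set \<Rightarrow> 3" where c: "\<And>X Y u v. X \<in> \<F> \<Longrightarrow> Y \<in> \<F> \<Longrightarrow> (u, v) \<in> X \<Longrightarrow> (v, u) \<in> Y \<Longrightarrow> g u v = c X - c Y"
      using face_structure_potential[OF fs] by metis
    \<comment> \<open>On old darts a new face acts as the face that it came from.\<close>
    define old where "old X = (if X \<in> {D1, D2} then D else X)" for X
    have old: "old X \<in> \<F>" "X \<inter> S \<subseteq> old X" if "X \<in> ?F" for X
    proof -
      have "D1 \<subseteq> D \<union> R\<inverse>" "D2 \<subseteq> D \<union> R" unfolding D(2) D1_def D2_def by (simp_all add: le_supI1 le_supI2)
      then have "D1 \<inter> S \<subseteq> D" "D2 \<inter> S \<subseteq> D"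
        using Int_subset_of_extension[OF _ RiS] Int_subset_of_extension[OF _ RS] by simp_all
      then show "old X \<in> \<F>" "X \<inter> S \<subseteq> old X" using that D(1) unfolding old_def by (auto simp only: insert_iff empty_iff Diff_iff split: if_splits)
    qed
    have "f u v = (c (old X) + k * of_bool (X = D2)) - (c (old Y) + k * of_bool (Y = D2))"
      if X: "X \<in> ?F" "(u, v) \<in> X" and Y: "Y \<in> ?F" "(v, u) \<in> Y" for X Y u v
    proof -
      have "(u, v) \<in> D2 \<longleftrightarrow> X = D2" using X disjF[of X D2] by fastforce
      moreover have "(v, u) \<in> D2 \<longleftrightarrow> Y = D2" using Y disjF[of Y D2] by fastforce
      ultimately have f: "f u v = g u v + k * (of_bool (X = D2) - of_bool (Y = D2))"
        unfolding g_def circulation_def by simp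
      have "g u v = c (old X) - c (old Y)"
      proof (cases "(u, v) \<in> S")
        case True
        then have "(v, u) \<in> S" by (simp only: sym)
        with True have "(u, v) \<in> old X" "(v, u) \<in> old Y"
          using subsetD[OF old(2)[OF X(1)] IntI[OF X(2)]] subsetD[OF old(2)[OF Y(1)] IntI[OF Y(2)]] by simp_all
        then show ?thesis using c[OF old(1)[OF X(1)] old(1)[OF Y(1)]] by simp
      next
        \<comment> \<open>On the ear both faces inherit the value of \<open>D\<close>, in accordance
          with \<open>g\<close> being zero there.\<close>
        case False
        then have "(v, u) \<notin> S" by (simp only: sym not_False_eq_True)
        then have "X \<notin> \<F>" "Y \<notin> \<F>"
          using UnionI[OF _ X(2), of \<F>] UnionI[OF _ Y(2), of \<F>] False by (simp_all only: F(2)) blast+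
        then have "X \<in> {D1, D2}" "Y \<in> {D1, D2}" using X(1) Y(1) by simp_all
        then show ?thesis using g0[OF False] unfolding old_def by simp
      qed
      then show ?thesis using f by (simp add: algebra_simps)
    qed
    then have "\<forall>X\<in>?F. \<forall>Y\<in>?F. \<forall>u v. (u, v) \<in> X \<and> (v, u) \<in> Y \<longrightarrow>
       f u v = (c (old X) + k * of_bool (X = D2)) - (c (old Y) + k * of_bool (Y = D2))"
      by (intro ballI allI impI) (elim conjE)
    then show ?thesis by (rule exI[of _ "\<lambda>X. c (old X) + k * of_bool (X = D2)"])
  qed
  have dc: "\<forall>X\<in>?F. dcycle X" using F(1) c1 c2 by simp
  have dj: "\<forall>X\<in>?F. \<forall>Y\<in>?F. X \<noteq> Y \<longrightarrow> X \<inter> Y = {}" using disjF by (intro ballI impI)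
  show "face_structure V ?S ?F"
    unfolding face_structure_def
    by (rule conjI[OF dc conjI[OF UF conjI[OF S'(1) conjI[OF S'(2) conjI[OF dj]]]]]) (intro allI impI pot)
qed

section \<open>Adding an ear to a plane graph\<close>

text \<open>Serves to place the ends of an ear in the closure of the region that contains its
  interior.\<close>

lemma arc_subset_closure_interior:
  fixes c :: "real \<Rightarrow> complex"
  assumes "arc c"
  shows "path_image c \<subseteq> closure (path_image c - {pathstart c, pathfinish c})"
proof -
  have "path_image c - {pathstart c, pathfinish c} = c ` {0<..<1}"
    using simple_path_endless[OF arc_imp_simple_path[OF assms]] .
  moreover have "c ` closure {0<..<1} \<subseteq> closure (c ` {0<..<1})"
    using assms by (intro image_closure_subset closure_subset) (auto simp: arc_def path_def)
  ultimately show ?thesis by (simp add: path_image_def)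
qed

lemma distinct_path_of_rtranclp:
  assumes "r\<^sup>*\<^sup>* x y"
  shows "\<exists>p. p \<noteq> [] \<and> distinct p \<and> hd p = x \<and> last p = y \<and> darts p \<subseteq> {(u, v). r u v}"
  using assms
proof (induction rule: rtranclp_induct)
  case base
  then show ?case by (intro exI[of _ "[x]"]) simp
next
  case (step y z)
  then obtain p where p: "p \<noteq> []" "distinct p" "hd p = x" "last p = y" "darts p \<subseteq> {(u, v). r u v}" by blast
  show ?case
  proof (cases "z \<in> set p")
    case True
    then obtain us vs where uv: "p = us @ z # vs" by (meson split_list)
    then have "darts (us @ [z]) \<subseteq> {(u, v). r u v}" using p(5) darts_append[of us z vs] by auto
    moreover have "hd (us @ [z]) = x" using p(3) uv by (cases us) auto
    ultimately show ?thesis using p(2) uv by (intro exI[of _ "us @ [z]"]) auto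
  next
    case False
    have "p = butlast p @ [y]" using p by (metis append_butlast_last_id)
    then have "darts (p @ [z]) = darts p \<union> {(y, z)}"
      using darts_append[of "butlast p" y "[z]"] by (metis append_Cons append_Nil append_assoc darts.simps(1,3))
    then show ?thesis using p False step(2) by (intro exI[of _ "p @ [z]"]) auto
  qed
qed

text \<open>A walk cut at its first vertex in \<open>A\<close>. Only the sources of its steps are
  kept out of \<open>A\<close>, so that the last step may enter it.\<close>

lemma rtranclp_first_hit:
  assumes "r\<^sup>*\<^sup>* v u" "u \<in> A"
  shows "\<exists>w\<in>A. (\<lambda>x y. r x y \<and> x \<notin> A)\<^sup>*\<^sup>* v w"
  using assms
proof (induction rule: converse_rtranclp_induct)
  case (step y z)
  show ?case
  proof (cases "y \<in> A")
    case False
    obtain w where "w \<in> A" "(\<lambda>x y. r x y \<and> x \<notin> A)\<^sup>*\<^sup>* z w" using step by blast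
    then show ?thesis
      using converse_rtranclp_into_rtranclp[of "\<lambda>x y. r x y \<and> x \<notin> A" y z w] False step(1) by blast
  qed auto
qed auto

lemma verts_darts: "w \<in> fst ` darts xs \<union> snd ` darts xs \<Longrightarrow> w \<in> set xs"
  using darts_in_set'[of _ _ xs] by auto

lemma region_complement:
  "(R1 \<union> R2) \<inter> C = {} \<Longrightarrow> R \<subseteq> - S \<Longrightarrow> C - K \<subseteq> R \<Longrightarrow> K \<subseteq> S \<Longrightarrow> R1 \<union> R2 \<union> (C - K) = R \<Longrightarrow>
    R1 \<union> R2 \<union> (- S - R) = - (S \<union> C)"
  by blast

section \<open>Drawings in the plane: arcs along paths and regions of cycles\<close>

locale plane_graph =
  fixes V :: "'a set" and E :: "'a set set" and pos :: "'a \<Rightarrow> complex" and \<gamma> :: "'a set \<Rightarrow> real \<Rightarrow> complex"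
  assumes simple: "simple_graph V E" and inj_pos: "inj_on pos V"
    and arcs: "e \<in> E \<Longrightarrow> arc (\<gamma> e)"
    and ends: "e \<in> E \<Longrightarrow> {pathstart (\<gamma> e), pathfinish (\<gamma> e)} = pos ` e"
    and on_arc: "e \<in> E \<Longrightarrow> path_image (\<gamma> e) \<inter> pos ` V = pos ` e"
    and crossing_free: "e \<in> E \<Longrightarrow> f \<in> E \<Longrightarrow> e \<noteq> f \<Longrightarrow> path_image (\<gamma> e) \<inter> path_image (\<gamma> f) \<subseteq> pos ` (e \<inter> f)"
begin

definition edarts :: "('a \<times> 'a) set" where "edarts = {(u, v). {u, v} \<in> E}"

definition dr :: "('a \<times> 'a) set \<Rightarrow> complex set" where
  "dr D = (\<Union>(u, v)\<in>D. path_image (\<gamma> {u, v}))"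

lemma edge_V: "{u, v} \<in> E \<Longrightarrow> u \<in> V \<and> v \<in> V \<and> u \<noteq> v"
  using simple unfolding simple_graph_def by fastforce

lemma edarts_V: "edarts \<subseteq> V \<times> V" using edge_V unfolding edarts_def by auto

lemma finite_V: "finite V" using simple unfolding simple_graph_def by auto

lemma dr_Un: "dr (A \<union> B) = dr A \<union> dr B" unfolding dr_def by auto

lemma dr_converse: "dr (A\<inverse>) = dr A"
  unfolding dr_def by (auto simp: insert_commute)

lemma dr_mono: "A \<subseteq> B \<Longrightarrow> dr A \<subseteq> dr B" unfolding dr_def by auto

lemma pos_in_dr: "(u, v) \<in> D \<Longrightarrow> D \<subseteq> edarts \<Longrightarrow> pos u \<in> dr D \<and> pos v \<in> dr D"
  using on_arc[of "{u, v}"] edge_V[of u v] unfolding dr_def edarts_def by fastforce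

lemma pos_in_drD:
  assumes "pos a \<in> dr D" "D \<subseteq> edarts" "a \<in> V"
  shows "a \<in> fst ` D \<union> snd ` D"
proof -
  obtain u v where uv: "(u, v) \<in> D" "pos a \<in> path_image (\<gamma> {u, v})" using assms(1) unfolding dr_def by auto
  then have "{u, v} \<in> E" using assms unfolding edarts_def by auto
  then have "pos a \<in> pos ` {u, v}" using on_arc uv assms(3) by blast
  then have "a \<in> {u, v}" using inj_pos assms(3) edge_V[OF \<open>{u, v} \<in> E\<close>] by (auto dest: inj_onD)
  then show ?thesis using uv by force
qed

text \<open>The converse of \<open>B\<close> must be avoided as well because opposite darts are
  drawn by the same arc.\<close>

lemma dr_Int:
  assumes "A \<subseteq> edarts" "B \<subseteq> edarts" "A \<inter> B = {}" "A \<inter> B\<inverse> = {}" "x \<in> dr A" "x \<in> dr B"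
  obtains w where "x = pos w" "w \<in> fst ` A \<union> snd ` A" "w \<in> fst ` B \<union> snd ` B"
proof -
  obtain u v where uv: "(u, v) \<in> A" "x \<in> path_image (\<gamma> {u, v})" using assms unfolding dr_def by auto
  obtain u' v' where uv': "(u', v') \<in> B" "x \<in> path_image (\<gamma> {u', v'})" using assms unfolding dr_def by auto
  have "{u, v} \<noteq> {u', v'}" using uv uv' assms by (auto simp: doubleton_eq_iff)
  moreover have "{u, v} \<in> E" "{u', v'} \<in> E" using uv uv' assms unfolding edarts_def by auto
  ultimately have "x \<in> pos ` ({u, v} \<inter> {u', v'})" using crossing_free uv uv' by blast
  then obtain w where "x = pos w" "w \<in> {u, v}" "w \<in> {u', v'}" by auto
  then show ?thesis using that[of w] uv uv' by force
qed

lemma path_arc: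
  assumes "distinct (u # p)" "p \<noteq> []" "darts (u # p) \<subseteq> edarts"
  shows "\<exists>c. arc c \<and> pathstart c = pos u \<and> pathfinish c = pos (last p) \<and> path_image c = dr (darts (u # p))"
  using assms
proof (induction p arbitrary: u)
  case (Cons v p)
  have e: "{u, v} \<in> E" using Cons.prems unfolding edarts_def by simp
  \<comment> \<open>The arc of an edge may be parametrised in either direction, hence the possible
    reversal.\<close>
  have "\<exists>c. arc c \<and> pathstart c = pos u \<and> pathfinish c = pos v \<and> path_image c = path_image (\<gamma> {u, v})"
  proof -
    have d: "pathstart (\<gamma> {u, v}) \<noteq> pathfinish (\<gamma> {u, v})" using arc_distinct_ends[OF arcs[OF e]] by simp
    have "{pathstart (\<gamma> {u, v}), pathfinish (\<gamma> {u, v})} = {pos u, pos v}" using ends[OF e] by simp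
    then consider "pathstart (\<gamma> {u, v}) = pos u" "pathfinish (\<gamma> {u, v}) = pos v" |
       "pathstart (\<gamma> {u, v}) = pos v" "pathfinish (\<gamma> {u, v}) = pos u" using d by (metis doubleton_eq_iff)
    then show ?thesis
    proof cases
      case 1
      then show ?thesis using arcs[OF e] by blast
    next
      case 2
      then show ?thesis using arcs[OF e] by (intro exI[of _ "reversepath (\<gamma> {u, v})"]) (simp add: arc_reversepath)
    qed
  qed
  then obtain c where c: "arc c" "pathstart c = pos u" "pathfinish c = pos v" "path_image c = path_image (\<gamma> {u, v})" by blast
  show ?case
  proof (cases "p = []")
    case True
    then show ?thesis using c by (intro exI[of _ c]) (simp add: dr_def)
  next
    case False
    have sub: "darts (v # p) \<subseteq> edarts" using Cons.prems by simp
    obtain c' where c': "arc c'" "pathstart c' = pos v" "pathfinish c' = pos (last p)" "path_image c' = dr (darts (v # p))"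
      using Cons.IH[of v] Cons.prems False sub by auto
    have "path_image c \<inter> path_image c' \<subseteq> {pathstart c'}"
    proof
      fix x assume x: "x \<in> path_image c \<inter> path_image c'"
      have n: "{(u, v)} \<inter> darts (v # p) = {}" "{(u, v)} \<inter> (darts (v # p))\<inverse> = {}"
        using Cons.prems(1) by (auto dest: darts_in_set')
      have 1: "{(u, v)} \<subseteq> edarts" using e unfolding edarts_def by simp
      have 2: "x \<in> dr {(u, v)}" using x c(4) by (simp add: dr_def)
      have 3: "x \<in> dr (darts (v # p))" using x c'(4) by simp
      obtain w where w: "x = pos w" "w \<in> fst ` {(u, v)} \<union> snd ` {(u, v)}"
        "w \<in> fst ` darts (v # p) \<union> snd ` darts (v # p)"
        by (rule dr_Int[OF 1 sub n 2 3])
      have "w \<in> set (v # p)" by (rule verts_darts[OF w(3)])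
      then have "w = v" using w(2) Cons.prems(1) by auto
      then show "x \<in> {pathstart c'}" using w(1) c'(2) by simp
    qed
    then have "arc (c +++ c')" by (intro arc_join c(1) c'(1)) (simp add: c(3) c'(2))
    moreover have "path_image (c +++ c') = dr (darts (u # v # p))"
      using c(3,4) c'(2,4) by (simp add: path_image_join dr_def)
    moreover have "pathstart (c +++ c') = pos u" "pathfinish (c +++ c') = pos (last (v # p))"
      using c(2) c'(3) False by simp_all
    ultimately show ?thesis by blast
  qed
qed simp

text \<open>Each region is a component of the complement of its own cycle, the form in which
  \<open>theta_split\<close> takes and returns regions. No condition ties the direction of a cycle
  to the side on which its region lies, so the plane need not be oriented.\<close>

definition plane_faces :: "('a \<times> 'a) set \<Rightarrow> ('a \<times> 'a) set set \<Rightarrow> bool" where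
  "plane_faces S \<F> \<longleftrightarrow> face_structure V S \<F> \<and> S \<subseteq> edarts \<and>
     (\<exists>R. (\<forall>D\<in>\<F>. R D \<in> components (- dr D)) \<and> (\<forall>D\<in>\<F>. \<forall>D'\<in>\<F>. D \<noteq> D' \<longrightarrow> R D \<inter> R D' = {}) \<and>
       (\<Union>D\<in>\<F>. R D) = - dr S)"

lemma closed_dr: assumes "D \<subseteq> edarts" shows "closed (dr D)"
proof -
  have "finite edarts" using finite_V edarts_V finite_subset by blast
  then have "finite D" using assms finite_subset by blast
  moreover have "closed (path_image (\<gamma> {u, v}))" if "(u, v) \<in> D" for u v
    using that assms arcs[of "{u, v}"] by (intro closed_arc_image) (auto simp: edarts_def)
  ultimately show ?thesis unfolding dr_def by (intro closed_UN) auto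
qed

lemma cycle_arcs:
  assumes "distinct (a # ps @ b # qs)" "darts (a # ps @ [b]) \<union> darts (b # qs @ [a]) \<subseteq> edarts"
    and "dcycle (darts (a # ps @ [b]) \<union> darts (b # qs @ [a]))"
  obtains c1 c2 where "arc c1" "arc c2" "pathstart c1 = pos a" "pathfinish c1 = pos b" "pathstart c2 = pos a" "pathfinish c2 = pos b"
    "path_image c1 = dr (darts (a # ps @ [b]))" "path_image c2 = dr (darts (b # qs @ [a]))"
    "path_image c1 \<inter> path_image c2 = {pos a, pos b}"
proof -
  let ?P = "darts (a # ps @ [b])" and ?Q = "darts (b # qs @ [a])"
  obtain c1 where c1: "arc c1" "pathstart c1 = pos a" "pathfinish c1 = pos b" "path_image c1 = dr ?P"
    using path_arc[of a "ps @ [b]"] assms by auto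
  obtain c2 where c2: "arc c2" "pathstart c2 = pos b" "pathfinish c2 = pos a" "path_image c2 = dr ?Q"
    using path_arc[of b "qs @ [a]"] assms by auto
  have "path_image c1 \<inter> path_image c2 = {pos a, pos b}"
  proof (rule equalityI)
    show "{pos a, pos b} \<subseteq> path_image c1 \<inter> path_image c2"
      using c1 c2 by (metis Int_iff empty_subsetI insert_subset pathfinish_in_path_image pathstart_in_path_image)
    show "path_image c1 \<inter> path_image c2 \<subseteq> {pos a, pos b}"
    proof
      fix x assume x: "x \<in> path_image c1 \<inter> path_image c2"
      have d: "?P \<inter> ?Q = {}" using darts_split_disjoint[OF assms(1)] .
      have "?P \<inter> ?Q\<inverse> = {}"
      proof (rule equals0I)
        fix d assume "d \<in> ?P \<inter> ?Q\<inverse>"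
        then show False using dcycle_antisym[OF assms(3), of "fst d" "snd d"] by (cases d) auto
      qed
      note d' = this
      have 1: "?P \<subseteq> edarts" "?Q \<subseteq> edarts" using assms(2) by simp_all
      have 2: "x \<in> dr ?P" "x \<in> dr ?Q" using x c1(4) c2(4) by simp_all
      obtain w where w: "x = pos w" "w \<in> fst ` ?P \<union> snd ` ?P" "w \<in> fst ` ?Q \<union> snd ` ?Q"
        by (rule dr_Int[OF 1 d d' 2])
      have "w \<in> set (a # ps @ [b])" "w \<in> set (b # qs @ [a])" by (rule verts_darts[OF w(2)], rule verts_darts[OF w(3)])
      then have "w \<in> {a, b}" using assms(1) by auto
      then show "x \<in> {pos a, pos b}" using w by auto
    qed
  qed
  then show ?thesis using that[of c1 "reversepath c2"] c1 c2 by (simp add: arc_reversepath)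
qed

lemma plane_faces_dcycle:
  assumes D: "dcycle D" "D \<subseteq> edarts"
  shows "plane_faces (D \<union> D\<inverse>) {D, D\<inverse>}"
proof -
  obtain x ys where ys: "distinct (x # ys)" "2 \<le> length ys" "D = darts (x # ys @ [x])"
    using D(1) unfolding dcycle_def by blast
  then obtain y zs where y: "ys = y # zs" by (cases ys) auto
  have D': "D = darts (x # [] @ [y]) \<union> darts (y # zs @ [x])" using ys y by auto
  obtain c1 c2 where c: "arc c1" "arc c2" "pathstart c1 = pos x" "pathfinish c1 = pos y" "pathstart c2 = pos x" "pathfinish c2 = pos y"
    "path_image c1 = dr (darts (x # [] @ [y]))" "path_image c2 = dr (darts (y # zs @ [x]))"
    "path_image c1 \<inter> path_image c2 = {pos x, pos y}"
    using cycle_arcs[of x "[]" y zs] D ys y D' by auto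
  have img: "path_image c1 \<union> path_image c2 = dr D" unfolding c D' dr_Un ..
  note J = Jordan_two_arcs[OF c(1-6,9), unfolded img]
  have anti: "D \<inter> D\<inverse> = {}" using dcycle_antisym[OF D(1)] by auto
  have "(x, y) \<in> D" using D' by simp
  then have ne: "D \<noteq> D\<inverse>" using anti by auto
  have drS: "dr (D \<union> D\<inverse>) = dr D" "dr (D\<inverse>) = dr D" by (simp_all add: dr_Un dr_converse)
  have "D\<inverse> \<subseteq> edarts" using D(2) unfolding edarts_def by (auto simp: insert_commute)
  moreover have "face_structure V (D \<union> D\<inverse>) {D, D\<inverse>}"
    by (rule face_structure_dcycle[OF D(1) order_trans[OF D(2) edarts_V] finite_V])
  moreover have "\<exists>R. (\<forall>X\<in>{D, D\<inverse>}. R X \<in> components (- dr X)) \<and> (\<forall>X\<in>{D, D\<inverse>}. \<forall>Y\<in>{D, D\<inverse>}. X \<noteq> Y \<longrightarrow> R X \<inter> R Y = {}) \<and>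
       (\<Union>X\<in>{D, D\<inverse>}. R X) = - dr (D \<union> D\<inverse>)"
  \<comment> \<open>Which of the two directions of the cycle receives the inside is an arbitrary
    choice.\<close>
  proof (intro exI[of _ "\<lambda>X. if X = D then inside (dr D) else outside (dr D)"] conjI)
    have J1: "inside (dr D) \<in> components (- dr D)" "outside (dr D) \<in> components (- dr D)" using J(1) by simp_all
    show "\<forall>X\<in>{D, D\<inverse>}. (if X = D then inside (dr D) else outside (dr D)) \<in> components (- dr X)"
      using J1 drS(2) ne by simp
    show "\<forall>X\<in>{D, D\<inverse>}. \<forall>Y\<in>{D, D\<inverse>}. X \<noteq> Y \<longrightarrow>
       (if X = D then inside (dr D) else outside (dr D)) \<inter> (if Y = D then inside (dr D) else outside (dr D)) = {}"
      using ne inside_Int_outside[of "dr D"] by (simp add: Int_commute)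
    show "(\<Union>X\<in>{D, D\<inverse>}. if X = D then inside (dr D) else outside (dr D)) = - dr (D \<union> D\<inverse>)"
      using ne inside_Un_outside[of "dr D"] by (simp add: drS(1) Un_commute)
  qed
  ultimately show ?thesis using D(2) unfolding plane_faces_def by (intro conjI Un_least)
qed

text \<open>The open ear is connected and avoids the drawing, so it lies in a single region; its
  ends lie on the boundary of that region, hence on the cycle of the same face. Topology thus finds
  the face to be split, and \<open>face_structure_ear\<close> splits it.\<close>

lemma plane_faces_ear:
  assumes pf: "plane_faces S \<F>"
    and ear: "distinct (a # rs @ [b])" "darts (a # rs @ [b]) \<subseteq> edarts" "set rs \<inter> fst ` S = {}" "(a, b) \<notin> S \<or> rs \<noteq> []"
    and ab: "a \<in> fst ` S" "b \<in> fst ` S"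
  defines "R \<equiv> darts (a # rs @ [b])"
  shows "\<exists>\<F>'. plane_faces (S \<union> R \<union> R\<inverse>) \<F>'"
proof -
  have fs: "face_structure V S \<F>" and SE: "S \<subseteq> edarts" using pf unfolding plane_faces_def by auto
  note F = face_structureD[OF fs]
  obtain reg where reg: "\<And>D. D \<in> \<F> \<Longrightarrow> reg D \<in> components (- dr D)"
    "\<And>D D'. D \<in> \<F> \<Longrightarrow> D' \<in> \<F> \<Longrightarrow> D \<noteq> D' \<Longrightarrow> reg D \<inter> reg D' = {}" "(\<Union>D\<in>\<F>. reg D) = - dr S"
    using pf unfolding plane_faces_def by metis
  obtain c where c: "arc c" "pathstart c = pos a" "pathfinish c = pos b" "path_image c = dr R"
    using path_arc[of a "rs @ [b]"] ear unfolding R_def by auto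
  have RE: "R \<subseteq> edarts" using ear R_def by simp
  have sndS: "snd ` S = fst ` S" using F(3) by (force dest: symD)
  have rsV: "set rs \<subseteq> V"
  proof
    fix r assume "r \<in> set rs"
    then have "r \<in> fst ` R" using fst_darts[of "a # rs" b] unfolding R_def by simp
    then show "r \<in> V" using RE edarts_V by auto
  qed
  have abV: "a \<in> V" "b \<in> V" using ab F(4) by auto
  let ?K = "{pos a, pos b}"
  have KS: "?K \<subseteq> dr S" using ab SE pos_in_dr by fastforce
  have RS: "R \<inter> S = {}"
  proof (rule equals0I)
    fix d assume d: "d \<in> R \<inter> S"
    obtain u v where uv: "d = (u, v)" by (cases d)
    have "u \<in> fst ` S" "v \<in> fst ` S" using d uv sndS by force+
    moreover have "u \<in> set (a # rs)" "v \<in> set (rs @ [b])"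
      using d uv darts_in_set[of u v "a # rs @ [b]"] unfolding R_def by (auto simp: butlast_append)
    ultimately have "u = a" "v = b" using ear(3) by auto
    then have in1: "(a, b) \<in> R" "(a, b) \<in> S" using d uv by auto
    then obtain r rs' where r: "rs = r # rs'" using ear(4) by (cases rs) auto
    then have "(a, b) \<in> darts (r # rs' @ [b])" using in1(1) ear(1) unfolding R_def by auto
    then show False using ear(1) r by (auto dest: darts_in_set')
  qed
  have cS: "dr R \<inter> dr S \<subseteq> ?K"
  proof
    fix x assume x: "x \<in> dr R \<inter> dr S"
    have RSc: "R \<inter> S\<inverse> = {}" using RS F(3) by (auto dest: symD)
    obtain w where w: "x = pos w" "w \<in> fst ` R \<union> snd ` R" "w \<in> fst ` S \<union> snd ` S"
      by (rule dr_Int[OF RE SE RS RSc IntD1[OF x] IntD2[OF x]])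
    have "w \<in> set (a # rs @ [b])" using w(2) unfolding R_def by (auto dest: darts_in_set')
    then show "x \<in> ?K" using w(1,3) ear(3) sndS by auto
  qed
  have int: "connected (path_image c - ?K)" "path_image c - ?K \<noteq> {}"
    using arc_interior_connected[OF c(1)] c by auto
  have "path_image c - ?K \<subseteq> (\<Union>D\<in>\<F>. reg D)" unfolding reg(3) c(4) using cS by blast
  then obtain D where D: "D \<in> \<F>" "reg D \<inter> (path_image c - ?K) \<noteq> {}" using int(2) by blast
  have DS: "D \<subseteq> S" using Union_upper[OF D(1)] unfolding F(2) .
  then have DE: "D \<subseteq> edarts" using SE by simp
  have drDS: "dr D \<subseteq> dr S" using DS dr_mono by simp
  have cD: "path_image c - ?K \<subseteq> reg D"
    using components_maximal[OF reg(1)[OF D(1)] int(1) _ D(2)] cS c drDS by auto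
  \<comment> \<open>An end of the ear lies in the closure of \<open>reg D\<close> but not in
    \<open>reg D\<close>, hence on its frontier, which is part of \<open>dr D\<close>; and a vertex
    placed on \<open>dr D\<close> belongs to the cycle.\<close>
  have end_in: "x \<in> fst ` D" if "x = a \<or> x = b" for x
  proof -
    have "pos x \<in> path_image c" using that c by (metis pathstart_in_path_image pathfinish_in_path_image)
    then have "pos x \<in> closure (reg D)"
      using arc_subset_closure_interior[OF c(1), unfolded c(2,3)] closure_mono[OF cD] by blast
    moreover have "closure (reg D) \<subseteq> reg D \<union> dr D"
    proof -
      have "frontier (reg D) \<subseteq> frontier (- dr D)" using frontier_of_components_subset[OF reg(1)[OF D(1)]] .
      also have "\<dots> \<subseteq> dr D" using closed_dr[OF DE] by (simp add: frontier_subset_closed)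
      finally show ?thesis unfolding closure_Un_frontier by auto
    qed
    moreover have "pos x \<notin> reg D" using that KS reg(3) D(1) by blast
    ultimately have "x \<in> fst ` D \<union> snd ` D" using pos_in_drD[OF _ DE] that abV by (metis UnE subsetD)
    then show ?thesis using dcycle_snd[OF F(1)[OF D(1)]] by simp
  qed
  have "a \<noteq> b" using ear(1) by auto
  obtain ps qs where pq: "distinct (a # ps @ b # qs)" "D = darts (a # ps @ [b]) \<union> darts (b # qs @ [a])"
    by (rule dcycle_split[OF F(1)[OF D(1)] end_in[OF disjI1[OF refl]] end_in[OF disjI2[OF refl]] \<open>a \<noteq> b\<close>])
  define D1 where "D1 = darts (a # ps @ [b]) \<union> R\<inverse>"
  define D2 where "D2 = R \<union> darts (b # qs @ [a])"
  let ?S = "S \<union> R \<union> R\<inverse>" and ?F = "insert D1 (insert D2 (\<F> - {D}))"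
  have fs': "face_structure V ?S ?F"
    using face_structure_ear[OF fs finite_V D(1) pq(2) pq(1) ear(1) rsV ear(3,4)] unfolding R_def D1_def D2_def .
  obtain c1 c2 where cc: "arc c1" "arc c2" "pathstart c1 = pos a" "pathfinish c1 = pos b" "pathstart c2 = pos a" "pathfinish c2 = pos b"
    "path_image c1 = dr (darts (a # ps @ [b]))" "path_image c2 = dr (darts (b # qs @ [a]))"
    "path_image c1 \<inter> path_image c2 = ?K"
    by (rule cycle_arcs[OF pq(1) DE[unfolded pq(2)] F(1)[OF D(1), unfolded pq(2)]])
  have c12: "path_image c1 \<union> path_image c2 = dr D" unfolding cc pq(2) dr_Un ..
  have ci: "path_image ci \<inter> path_image c = ?K" if "pathstart ci = pos a" "pathfinish ci = pos b" "path_image ci \<subseteq> dr D" for ci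
  proof -
    have "path_image ci \<inter> path_image c \<subseteq> ?K" using that(3) drDS cS c(4) by auto
    moreover have "?K \<subseteq> path_image ci \<inter> path_image c"
      using that(1,2) c by (metis Int_iff empty_subsetI insert_subset pathfinish_in_path_image pathstart_in_path_image)
    ultimately show ?thesis by (rule equalityI)
  qed
  have i1: "path_image c1 \<inter> path_image c = ?K" and i2: "path_image c2 \<inter> path_image c = ?K"
    by (rule ci[OF cc(3,4)], simp add: c12[symmetric], rule ci[OF cc(5,6)], simp add: c12[symmetric])
  obtain R1 R2 where R12: "R1 \<in> components (- (path_image c1 \<union> path_image c))" "R2 \<in> components (- (path_image c2 \<union> path_image c))"
    "R1 \<inter> R2 = {}" "R1 \<union> R2 \<union> (path_image c - ?K) = reg D"
    by (rule theta_split[OF cc(1,2) c(1) cc(3-6) c(2,3) cc(9) i1 i2 reg(1)[OF D(1), folded c12] cD])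
  have img: "path_image c1 \<union> path_image c = dr D1" "path_image c2 \<union> path_image c = dr D2"
    unfolding D1_def D2_def dr_Un dr_converse cc c(4) by (simp_all add: Un_commute)
  have Rne: "R \<noteq> {}" unfolding R_def by (cases rs) auto
  have notin: "D1 \<notin> \<F>" "D2 \<notin> \<F>"
  proof -
    have "\<not> R\<inverse> \<subseteq> S" "\<not> R \<subseteq> S" using RS Rne F(3) by (auto dest: symD)
    then have "\<not> D1 \<subseteq> S" "\<not> D2 \<subseteq> S" unfolding D1_def D2_def by simp_all
    then show "D1 \<notin> \<F>" "D2 \<notin> \<F>" using Union_upper[of _ \<F>] unfolding F(2) by auto
  qed
  have "D1 \<noteq> D2"
  proof
    assume eq: "D1 = D2"
    obtain u v where "(u, v) \<in> R" using Rne by auto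
    then have "(u, v) \<in> D2" "(v, u) \<in> D1" unfolding D1_def D2_def by simp_all
    then have "(u, v) \<in> D1" "(v, u) \<in> D1" using eq by simp_all
    moreover have "dcycle D1" using face_structureD(1)[OF fs'] by simp
    ultimately show False using dcycle_antisym[of D1 u v] by simp
  qed
  define reg' where "reg' = (\<lambda>X. if X = D1 then R1 else if X = D2 then R2 else reg X)"
  have r': "reg' D1 = R1" "reg' D2 = R2" "X \<in> \<F> - {D} \<Longrightarrow> reg' X = reg X" for X
    using \<open>D1 \<noteq> D2\<close> notin unfolding reg'_def by auto
  have g1: "\<forall>X\<in>?F. reg' X \<in> components (- dr X)"
  proof
    fix X assume "X \<in> ?F"
    then consider "X = D1" | "X = D2" | "X \<in> \<F> - {D}" by blast
    then show "reg' X \<in> components (- dr X)"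
      using R12(1,2) img by cases (simp_all add: r' reg(1))
  qed
  have g2: "\<forall>X\<in>?F. \<forall>Y\<in>?F. X \<noteq> Y \<longrightarrow> reg' X \<inter> reg' Y = {}"
  proof (intro ballI impI)
    fix X Y assume X: "X \<in> ?F" "Y \<in> ?F" "X \<noteq> Y"
    have s: "R1 \<subseteq> reg D" "R2 \<subseteq> reg D" using R12 by auto
    have o: "reg D \<inter> reg Z = {}" if "Z \<in> \<F> - {D}" for Z using reg(2)[of D Z] D that by auto
    have k: "reg' Z \<subseteq> reg D" if "Z \<in> {D1, D2}" for Z
      using that by (elim insertE emptyE) (simp_all add: r' s)
    consider "X \<in> {D1, D2}" "Y \<in> {D1, D2}" | "X \<in> {D1, D2}" "Y \<in> \<F> - {D}"
      | "X \<in> \<F> - {D}" "Y \<in> {D1, D2}" | "X \<in> \<F> - {D}" "Y \<in> \<F> - {D}"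
      using X(1,2) unfolding insert_iff empty_iff by argo
    then show "reg' X \<inter> reg' Y = {}"
    proof cases
      case 1
      have "R2 \<inter> R1 = {}" using R12(3) by (simp only: Int_commute)
      with 1 X(3) R12(3) show ?thesis
        by (elim insertE emptyE) (simp_all add: r')
    next
      case 2
      then show ?thesis using k[of X] o[of Y] r'(3)[of Y] by blast
    next
      case 3
      then show ?thesis using k[of Y] o[of X] r'(3)[of X] by blast
    next
      case 4
      then show ?thesis using X(3) reg(2)[of X Y] r'(3) by simp
    qed
  qed
  have g3: "(\<Union>X\<in>?F. reg' X) = - dr ?S"
  proof -
    have "(\<Union>X\<in>?F. reg' X) = R1 \<union> R2 \<union> (\<Union>X\<in>\<F> - {D}. reg X)" using r' by auto
    also have "(\<Union>X\<in>\<F> - {D}. reg X) = - dr S - reg D"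
    proof -
      have "reg X \<inter> reg D = {}" if "X \<in> \<F> - {D}" for X using reg(2)[of X D] D(1) that by simp
      then show ?thesis unfolding reg(3)[symmetric] using D(1) by blast
    qed
    also have "R1 \<union> R2 \<union> (- dr S - reg D) = - (dr S \<union> path_image c)"
    proof -
      have "(R1 \<union> R2) \<inter> path_image c = {}"
        using in_components_subset[OF R12(1)] in_components_subset[OF R12(2)] by auto
      moreover have "reg D \<subseteq> - dr S" unfolding reg(3)[symmetric] using D(1) by blast
      ultimately show ?thesis using region_complement cD KS R12(4) by metis
    qed
    finally show ?thesis by (simp add: dr_Un dr_converse c(4))
  qed
  have "?S \<subseteq> edarts" using SE RE by (auto simp: edarts_def insert_commute)
  then have "plane_faces ?S ?F" unfolding plane_faces_def using fs' g1 g2 g3 by (intro conjI exI[of _ reg'])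
  then show ?thesis by blast
qed

end

section \<open>Ear decompositions of bridgeless cubic graphs\<close>

lemma rtranclp_leaves:
  assumes "r\<^sup>*\<^sup>* x y" "x \<in> A" "y \<notin> A"
  shows "\<exists>u v. u \<in> A \<and> v \<notin> A \<and> r u v"
  using assms by (induction rule: rtranclp_induct) auto

lemma card_neighbours:
  assumes "simple_graph V E" "cubic V E" "v \<in> V"
  shows "card {w. {v, w} \<in> E} = 3"
proof -
  have "{e \<in> E. v \<in> e} = (\<lambda>w. {v, w}) ` {w. {v, w} \<in> E}"
  proof (rule equalityI)
    show "{e \<in> E. v \<in> e} \<subseteq> (\<lambda>w. {v, w}) ` {w. {v, w} \<in> E}"
    proof
      fix e assume e: "e \<in> {e \<in> E. v \<in> e}"
      then have "card e = 2" using assms(1) unfolding simple_graph_def by auto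
      then obtain x y where "e = {x, y}" by (auto simp: card_2_iff)
      then have "\<exists>w. e = {v, w}" using e by auto
      then show "e \<in> (\<lambda>w. {v, w}) ` {w. {v, w} \<in> E}" using e by auto
    qed
  qed auto
  moreover have "inj_on (\<lambda>w. {v, w}) {w. {v, w} \<in> E}" by (auto simp: inj_on_def doubleton_eq_iff)
  moreover have "card {e \<in> E. v \<in> e} = 3" using assms(2,3) unfolding cubic_def degree_def by auto
  ultimately show ?thesis using card_image[of "\<lambda>w. {v, w}" "{w. {v, w} \<in> E}"] by simp
qed

section \<open>Growing a plane subgraph, from a cycle up to the whole graph\<close>

context plane_graph
begin

lemma exists_dcycle:
  assumes cub: "cubic V E" and ne: "V \<noteq> {}"
    and bl: "\<And>u v. {u, v} \<in> E \<Longrightarrow> (adj (E - {{u, v}}))\<^sup>*\<^sup>* v u"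
  shows "\<exists>D. dcycle D \<and> D \<subseteq> edarts"
proof -
  obtain u where "u \<in> V" using ne by auto
  then have "card {w. {u, w} \<in> E} = 3" using card_neighbours[OF simple cub] by simp
  then have "{w. {u, w} \<in> E} \<noteq> {}" by (metis card.empty zero_neq_numeral)
  then obtain v where uv: "{u, v} \<in> E" by auto
  obtain p where p: "p \<noteq> []" "distinct p" "hd p = v" "last p = u" "darts p \<subseteq> {(x, y). adj (E - {{u, v}}) x y}"
    using distinct_path_of_rtranclp[OF bl[OF uv]] by metis
  have "u \<noteq> v" using edge_V[OF uv] by simp
  obtain p' where p': "p = v # p'" using p(1,3) by (cases p) auto
  have "p' \<noteq> []" using p(4) p' \<open>u \<noteq> v\<close> by auto
  then obtain m where m: "p' = m @ [u]" using p(4) p' by (metis append_butlast_last_id last_ConsR)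
  \<comment> \<open>The path avoids the edge \<open>{u, v}\<close>, so it has an inner vertex and
    the cycle has at least three vertices.\<close>
  have "m \<noteq> []"
  proof
    assume "m = []"
    then have "(v, u) \<in> darts p" using p' m by simp
    then show False using p(5) by (auto simp: adj_def insert_commute)
  qed
  then have len: "2 \<le> length p'" using m by (cases m) auto
  have "darts (v # p' @ [v]) = darts p \<union> {(u, v)}"
    using darts_append[of "v # m" u "[v]"] p' m by simp
  moreover have "(u, v) \<in> edarts" using uv unfolding edarts_def by simp
  moreover have "darts p \<subseteq> edarts" using p(5) unfolding edarts_def adj_def by blast
  ultimately have "darts (v # p' @ [v]) \<subseteq> edarts" by simp
  moreover have "dcycle (darts (v # p' @ [v]))" using p(2) p' len by (intro dcycleI) auto
  ultimately show ?thesis by blast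
qed

text \<open>A missing edge at a vertex of the subgraph is continued, unless it is a chord, by a walk
  avoiding that edge, which exists because the edge is no bridge, up to the first vertex of the
  subgraph. Degree three forbids a return to the starting vertex: it has two neighbours on a face
  through it and would gain two more from the ear.\<close>

lemma exists_ear:
  assumes conn: "connected_graph V E" and cub: "cubic V E"
    and bl: "\<And>u v. {u, v} \<in> E \<Longrightarrow> (adj (E - {{u, v}}))\<^sup>*\<^sup>* v u"
    and pf: "plane_faces S \<F>" and S: "S \<noteq> {}" "S \<noteq> edarts"
  obtains a rs b where "distinct (a # rs @ [b])" "darts (a # rs @ [b]) \<subseteq> edarts" "set rs \<inter> fst ` S = {}" "(a, b) \<notin> S \<or> rs \<noteq> []"
    "a \<in> fst ` S" "b \<in> fst ` S"
proof -
  let ?A = "fst ` S"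
  have fs: "face_structure V S \<F>" and SE: "S \<subseteq> edarts" using pf unfolding plane_faces_def by auto
  note F = face_structureD[OF fs]
  have AV: "?A \<subseteq> V" using F(4) by auto
  have sndS: "snd ` S = ?A" using F(3) by (force dest: symD)
  have "\<exists>u v. u \<in> ?A \<and> {u, v} \<in> E \<and> (u, v) \<notin> S"
  proof (cases "?A = V")
    case True
    obtain u v where "(u, v) \<in> edarts" "(u, v) \<notin> S" using S(2) SE by auto
    then show ?thesis using True edarts_V unfolding edarts_def by blast
  next
    case False
    then obtain x where x: "x \<in> V" "x \<notin> ?A" using AV by blast
    obtain a where a: "a \<in> ?A" using S(1) by fastforce
    then have "(adj E)\<^sup>*\<^sup>* a x" using conn AV x unfolding connected_graph_def by blast
    then obtain u v where "u \<in> ?A" "v \<notin> ?A" "adj E u v" using rtranclp_leaves[of "adj E" a x ?A] a x by blast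
    moreover have "(u, v) \<notin> S" using \<open>v \<notin> ?A\<close> sndS by force
    ultimately show ?thesis unfolding adj_def by blast
  qed
  then obtain u v where uv: "u \<in> ?A" "{u, v} \<in> E" "(u, v) \<notin> S" by blast
  have "u \<noteq> v" using edge_V[OF uv(2)] by simp
  have uvE: "(u, v) \<in> edarts" using uv unfolding edarts_def by simp
  show thesis
  proof (cases "v \<in> ?A")
    case True
    show thesis by (rule that[of u "[]" v]) (use True uv uvE \<open>u \<noteq> v\<close> in auto)
  next
    case False
    let ?r = "\<lambda>x y. adj (E - {{u, v}}) x y \<and> x \<notin> ?A"
    obtain w where w: "w \<in> ?A" "?r\<^sup>*\<^sup>* v w" using rtranclp_first_hit[OF bl[OF uv(2)] uv(1)] by auto
    obtain p where p: "p \<noteq> []" "distinct p" "hd p = v" "last p = w" "darts p \<subseteq> {(x, y). ?r x y}"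
      using distinct_path_of_rtranclp[OF w(2)] by (elim exE conjE)
    have p5: "{x, y} \<in> E \<and> {x, y} \<noteq> {u, v} \<and> x \<notin> ?A" if "(x, y) \<in> darts p" for x y
      using subsetD[OF p(5) that] unfolding adj_def by simp
    define m where "m = butlast p"
    have pm: "p = m @ [w]" using p(1,4) m_def by (metis append_butlast_last_id)
    have mA: "set m \<inter> ?A = {}"
    proof -
      have "set m = fst ` darts p" unfolding pm fst_darts ..
      then have "x \<notin> ?A" if x: "x \<in> set m" for x
      proof -
        obtain d where "d \<in> darts p" "x = fst d" using x \<open>set m = fst ` darts p\<close> by blast
        then show ?thesis using p5[of "fst d" "snd d"] by simp
      qed
      then show ?thesis by blast
    qed
    have "v \<noteq> w" using w False by auto
    then have "m \<noteq> []" using p(3) pm by (cases m) auto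
    then obtain m' where m': "m = v # m'" using p(3) pm by (cases m) auto
    have pE: "darts p \<subseteq> edarts" using p5 unfolding edarts_def by auto
    have up: "darts (u # p) \<subseteq> edarts" using uvE pE unfolding pm m' by simp
    have um: "u \<notin> set m" using mA uv by auto
    have "w \<noteq> u"
    proof
      assume [simp]: "w = u"
      have "\<exists>y. (y, u) \<in> darts p \<and> y \<in> set m"
      proof -
        obtain k y where k: "m = k @ [y]" using \<open>m \<noteq> []\<close> by (metis append_butlast_last_id)
        then have "(y, u) \<in> darts p" unfolding pm using darts_append[of k y "[u]"] by simp
        then show ?thesis using k by auto
      qed
      then obtain y where y: "(y, u) \<in> darts p" "y \<in> set m" by blast
      \<comment> \<open>The walk does not use the edge \<open>{u, v}\<close>, so it would return to
        \<open>u\<close> from a neighbour other than \<open>v\<close>.\<close>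
      have "{y, u} \<noteq> {u, v}" "{y, u} \<in> E" "y \<notin> ?A" using p5[OF y(1)] by simp_all
      then have yv: "y \<noteq> v" "{u, y} \<in> E" by (auto simp: insert_commute)
      obtain x where "(u, x) \<in> S" using uv(1) by auto
      then obtain X where X: "X \<in> \<F>" "(u, x) \<in> X" using F(2) by auto
      have uX: "u \<in> fst ` X" using X(2) by force
      obtain s t where st: "s \<noteq> t" "\<And>z. (u, z) \<in> X \<longleftrightarrow> z = s" "\<And>z. (z, u) \<in> X \<longleftrightarrow> z = t"
        using dcycle_at[OF F(1)[OF X(1)] uX] by metis
      have XS: "X \<subseteq> S" using Union_upper[OF X(1)] F(2) by simp
      then have "(u, s) \<in> S" "(t, u) \<in> S" using st by auto
      then have "(u, s) \<in> S" "(u, t) \<in> S" using F(3) by (auto dest: symD)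
      then have st': "s \<in> ?A" "t \<in> ?A" "{u, s} \<in> E" "{u, t} \<in> E" using sndS SE unfolding edarts_def by force+
      have "card {v, y, s, t} = 4" using st' st(1) yv False \<open>y \<notin> ?A\<close> by (auto simp: card_insert_if)
      moreover have "{v, y, s, t} \<subseteq> {z. {u, z} \<in> E}" using st' yv uv by auto
      moreover have "card {z. {u, z} \<in> E} = 3" using card_neighbours[OF simple cub] uv(1) AV by auto
      moreover have "finite {z. {u, z} \<in> E}" using finite_V edge_V by (auto intro: finite_subset[of _ V])
      ultimately show False using card_mono[of "{z. {u, z} \<in> E}" "{v, y, s, t}"] by simp
    qed
    show thesis
    proof (rule that[of u m w])
      show "distinct (u # m @ [w])" using p(2) pm um \<open>w \<noteq> u\<close> by auto
      show "darts (u # m @ [w]) \<subseteq> edarts" using up pm by simp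
    qed (use mA \<open>m \<noteq> []\<close> uv w in auto)
  qed
qed

theorem exists_plane_faces:
  assumes conn: "connected_graph V E" and cub: "cubic V E"
    and bl: "\<And>u v. {u, v} \<in> E \<Longrightarrow> (adj (E - {{u, v}}))\<^sup>*\<^sup>* v u"
  shows "\<exists>\<F>. plane_faces edarts \<F>"
proof -
  have "V \<noteq> {}" using conn unfolding connected_graph_def by simp
  then obtain D where D: "dcycle D" "D \<subseteq> edarts" using exists_dcycle[OF cub _ bl] by blast
  have fin: "finite edarts" using finite_V edarts_V finite_subset by blast
  have "\<exists>\<F>'. plane_faces edarts \<F>'" if "plane_faces S \<F>" "S \<noteq> {}" for S \<F>
    using that
  proof (induction "card edarts - card S" arbitrary: S \<F> rule: less_induct)
    case less
    show ?case
    proof (cases "S = edarts")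
      case False
      have SE: "S \<subseteq> edarts" using less.prems unfolding plane_faces_def by auto
      obtain a rs b where ear: "distinct (a # rs @ [b])" "darts (a # rs @ [b]) \<subseteq> edarts" "set rs \<inter> fst ` S = {}" "(a, b) \<notin> S \<or> rs \<noteq> []"
        "a \<in> fst ` S" "b \<in> fst ` S"
        by (rule exists_ear[OF conn cub bl less.prems False])
      let ?R = "darts (a # rs @ [b])"
      obtain \<F>' where F': "plane_faces (S \<union> ?R \<union> ?R\<inverse>) \<F>'" using plane_faces_ear[OF less.prems(1) ear] by blast
      have SE': "S \<union> ?R \<union> ?R\<inverse> \<subseteq> edarts" using F' unfolding plane_faces_def by auto
      have "\<not> ?R \<subseteq> S"
      proof (cases rs)
        case (Cons r rs')
        then have "(a, r) \<in> ?R" by simp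
        moreover have "(a, r) \<notin> S"
        proof
          assume "(a, r) \<in> S"
          then have "(r, a) \<in> S" using less.prems unfolding plane_faces_def by (auto dest: face_structureD(3) symD)
          then show False using ear(3) Cons by force
        qed
        ultimately show ?thesis by blast
      qed (use ear(4) in auto)
      then have "S \<subset> S \<union> ?R \<union> ?R\<inverse>" by auto
      then have "card S < card (S \<union> ?R \<union> ?R\<inverse>)" using fin SE' by (meson finite_subset psubset_card_mono)
      moreover have "card (S \<union> ?R \<union> ?R\<inverse>) \<le> card edarts" using fin SE' card_mono by blast
      ultimately show ?thesis using less.hyps[OF _ F'] less.prems(2) by auto
    qed (use less.prems in blast)
  qed
  moreover have "D \<noteq> {}"
  proof -
    obtain x ys where "D = darts (x # ys @ [x])" using D(1) unfolding dcycle_def by auto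
    then show ?thesis by (cases ys) auto
  qed
  ultimately show ?thesis using plane_faces_dcycle[OF D] by blast
qed

end

section \<open>Face colourings\<close>

text \<open>Delete the edge and count the remaining edges on the side of \<open>v\<close> by their
  ends in either colour class. All degrees there are three, except that \<open>v\<close> has degree
  two; so one count gives a multiple of three and the other gives one less than a multiple of
  three.\<close>

lemma bipartite_cubic_no_bridge:
  assumes sg: "simple_graph V E" and bip: "\<And>e. e \<in> E \<Longrightarrow> card (e \<inter> A) = 1" and cub: "cubic V E" and uv: "{u, v} \<in> E"
  shows "(adj (E - {{u, v}}))\<^sup>*\<^sup>* v u"
proof (rule ccontr)
  assume neg: "\<not> ?thesis"
  define F where "F = E - {{u, v}}"
  define K where "K = {x. (adj F)\<^sup>*\<^sup>* v x}"
  define EK where "EK = {g \<in> F. g \<subseteq> K}"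
  have e2: "card g = 2" "g \<subseteq> V" if "g \<in> E" for g using sg that unfolding simple_graph_def by auto
  have finV: "finite V" using sg unfolding simple_graph_def by simp
  have "E \<subseteq> Pow V" using e2 by auto
  then have finE: "finite E" using finV finite_subset by blast
  have uK: "u \<notin> K" and vK: "v \<in> K" using neg unfolding K_def F_def by auto
  have uvV: "u \<in> V" "v \<in> V" "u \<noteq> v" using e2[OF uv] by (auto simp: card_insert_if split: if_splits)
  have KV: "K \<subseteq> V"
  proof
    fix x assume "x \<in> K"
    then have "(adj F)\<^sup>*\<^sup>* v x" unfolding K_def by simp
    then show "x \<in> V"
      by (induction rule: rtranclp_induct) (use uvV e2 in \<open>auto simp: adj_def F_def\<close>)
  qed
  have closed: "g \<subseteq> K" if h: "g \<in> F" "x \<in> g" "x \<in> K" for g x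
  proof -
    have "card g = 2" using e2 h unfolding F_def by auto
    then obtain y where g: "g = {x, y}" using h(2) by (auto simp: card_2_iff)
    then have "adj F x y" using h unfolding adj_def by simp
    then have "y \<in> K" using h(3) unfolding K_def by (simp add: rtranclp.rtrancl_into_rtrancl)
    then show ?thesis using g h by simp
  qed
  have deg: "card {g \<in> EK. x \<in> g} + of_bool (x = v) = 3" if "x \<in> K" for x
  proof -
    have eq: "{g \<in> EK. x \<in> g} = {g \<in> E. x \<in> g} - {{u, v}}"
      using closed that unfolding EK_def F_def by auto
    have 3: "card {g \<in> E. x \<in> g} = 3" using cub that KV unfolding cubic_def degree_def by auto
    show ?thesis
    proof (cases "x = v")
      case True
      then have "{u, v} \<in> {g \<in> E. x \<in> g}" using uv by simp
      then show ?thesis unfolding eq using 3 True by (simp add: card_Diff_singleton)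
    next
      case False
      then have "{u, v} \<notin> {g \<in> E. x \<in> g}" using that uK by auto
      then show ?thesis unfolding eq using 3 False by simp
    qed
  qed
  have finK: "finite K" "finite EK" using KV finV finE finite_subset unfolding EK_def F_def by auto
  have count: "card EK + of_bool (v \<in> X) = 3 * card X" if X: "X \<subseteq> K" "\<And>g. g \<in> EK \<Longrightarrow> card {x \<in> X. x \<in> g} = 1" for X
  proof -
    have finX: "finite X" using X(1) finK finite_subset by blast
    have "(\<Sum>x\<in>X. card {g \<in> EK. x \<in> g}) = 1 * card EK"
      using X(2) by (intro sum_multicount finX finK) auto
    then have "card EK + (\<Sum>x\<in>X. of_bool (x = v)) = (\<Sum>x\<in>X. card {g \<in> EK. x \<in> g} + of_bool (x = v))"
      by (simp add: sum.distrib)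
    also have "\<dots> = (\<Sum>x\<in>X. 3)" using X(1) by (intro sum.cong refl deg) auto
    finally have "card EK + (\<Sum>x\<in>X. of_bool (x = v)) = 3 * card X" by simp
    moreover have "(\<Sum>x\<in>X. of_bool (x = v)) = (of_bool (v \<in> X) :: nat)"
      using finX by (simp add: of_bool_def sum.delta')
    ultimately show ?thesis by simp
  qed
  have "card EK + of_bool (v \<in> K \<inter> A) = 3 * card (K \<inter> A)"
  proof (rule count)
    fix g assume "g \<in> EK"
    then have "{x \<in> K \<inter> A. x \<in> g} = g \<inter> A" "g \<in> E" unfolding EK_def F_def by auto
    then show "card {x \<in> K \<inter> A. x \<in> g} = 1" using bip by simp
  qed auto
  moreover have "card EK + of_bool (v \<in> K - A) = 3 * card (K - A)"
  proof (rule count)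
    fix g assume "g \<in> EK"
    then have g: "{x \<in> K - A. x \<in> g} = g - A" "g \<in> E" unfolding EK_def F_def by auto
    have "finite g" using e2[OF g(2)] finV finite_subset by blast
    then have "card (g - A) = card g - card (g \<inter> A)" by (simp add: card_Diff_subset_Int)
    then show "card {x \<in> K - A. x \<in> g} = 1" using bip[OF g(2)] g(1) e2(1)[OF g(2)] by simp
  qed auto
  ultimately show False using vK by (cases "v \<in> A") (simp_all, presburger+)
qed

text \<open>A cubic graph given by three perfect matchings \<open>m\<close>, \<open>s\<close>, \<open>t\<close> between \<open>A\<close> and its complement;
  \<open>\<phi>0 v\<close> and \<open>\<phi>1 v\<close> name the two faces on both sides of the \<open>s\<close>-edge at \<open>v\<close>, the first bounded
  by \<open>m\<close>- and \<open>s\<close>-edges, the second by \<open>s\<close>- and \<open>t\<close>-edges. All that remains of planarity is that every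
  flow is the coboundary of a potential on the faces.\<close>

locale tricoloured =
  fixes V A :: "'a set" and m s t :: "'a \<Rightarrow> 'a" and \<phi>0 \<phi>1 :: "'a \<Rightarrow> 'f"
  assumes fin: "finite V"
    and inV: "v \<in> V \<Longrightarrow> m v \<in> V" "v \<in> V \<Longrightarrow> s v \<in> V" "v \<in> V \<Longrightarrow> t v \<in> V"
    and inv: "v \<in> V \<Longrightarrow> m (m v) = v" "v \<in> V \<Longrightarrow> s (s v) = v" "v \<in> V \<Longrightarrow> t (t v) = v"
    and inA: "v \<in> V \<Longrightarrow> m v \<in> A \<longleftrightarrow> v \<notin> A" "v \<in> V \<Longrightarrow> s v \<in> A \<longleftrightarrow> v \<notin> A" "v \<in> V \<Longrightarrow> t v \<in> A \<longleftrightarrow> v \<notin> A"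
    and distinct_nbrs: "v \<in> V \<Longrightarrow> m v \<noteq> s v" "v \<in> V \<Longrightarrow> m v \<noteq> t v" "v \<in> V \<Longrightarrow> s v \<noteq> t v"
    and conn: "v \<in> V \<Longrightarrow> w \<in> V \<Longrightarrow> (\<lambda>x y. y \<in> {m x, s x, t x})\<^sup>*\<^sup>* v w"
    and faces: "v \<in> V \<Longrightarrow> \<phi>0 (m v) = \<phi>0 v" "v \<in> V \<Longrightarrow> \<phi>0 (s v) = \<phi>0 v" "v \<in> V \<Longrightarrow> \<phi>1 (s v) = \<phi>1 v" "v \<in> V \<Longrightarrow> \<phi>1 (t v) = \<phi>1 v"
    and potential: "flow V {(v, w). v \<in> V \<and> w \<in> {m v, s v, t v}} (f :: 'a \<Rightarrow> 'a \<Rightarrow> 3) \<Longrightarrow>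
      \<exists>c. \<forall>v\<in>V \<inter> A. f v (s v) = c (\<phi>1 v) - c (\<phi>0 v)"

section \<open>Three perfect matchings from the potential of a constant flow\<close>

context plane_graph
begin

text \<open>An edge takes as colour the potential of the face containing its dart that leaves
  \<open>A\<close>; the face on its other side has one less. So colour k separates faces of values k
  and k - 1, and turning round a vertex meets every colour. With the colours 0, 1, 2 for
  \<open>m\<close>, \<open>s\<close>, \<open>t\<close>, the \<open>s\<close>-edges lie between faces
  of values 1 and 0, and the faces of value 2 are bounded by \<open>m\<close>- and
  \<open>t\<close>-edges.\<close>

theorem exists_tricolouring:
  assumes conn: "connected_graph V E" and cub: "cubic V E" and bip: "\<And>e. e \<in> E \<Longrightarrow> card (e \<inter> A) = 1"
    and pf: "plane_faces edarts \<F>"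
  shows "\<exists>m s t (\<phi>0 :: 'a \<Rightarrow> ('a \<times> 'a) set) \<phi>1. tricoloured V A m s t \<phi>0 \<phi>1 \<and>
    (\<forall>u v. {u, v} \<in> E \<longleftrightarrow> u \<in> V \<and> v \<in> {m u, s u, t u})"
proof -
  have fs: "face_structure V edarts \<F>" using pf unfolding plane_faces_def by auto
  note F = face_structureD[OF fs]
  have bipA: "u \<in> A \<longleftrightarrow> v \<notin> A" if "{u, v} \<in> E" for u v
  proof -
    have "u \<noteq> v" using edge_V[OF that] by simp
    then show ?thesis using bip[OF that] by (cases "u \<in> A"; cases "v \<in> A") auto
  qed
  have sym: "{u, v} \<in> E \<longleftrightarrow> {v, u} \<in> E" for u v by (simp add: insert_commute)
  have nb3: "card {w. {v, w} \<in> E} = 3" if "v \<in> V" for v using card_neighbours[OF simple cub that] .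
  have nbV: "{w. {v, w} \<in> E} \<subseteq> V" for v using edge_V by auto
  define f :: "'a \<Rightarrow> 'a \<Rightarrow> 3" where "f u v = (if {u, v} \<in> E then if u \<in> A then 1 else - 1 else 0)" for u v
  have "flow V edarts f"
    unfolding flow_def
  proof (intro conjI allI impI)
    fix u v
    show "f v u = - f u v" using sym[of u v] bipA[of u v] unfolding f_def by auto
    show "f u v = 0" if "(u, v) \<notin> edarts" using that unfolding f_def edarts_def by auto
  next
    fix v
    have "(\<Sum>u\<in>V. f v u) = (\<Sum>u\<in>{w. {v, w} \<in> E}. if v \<in> A then 1 else - 1)"
      using finite_V nbV[of v] by (intro sum.mono_neutral_cong_right) (auto simp: f_def)
    also have "\<dots> = 0"
    proof (cases "v \<in> V")
      case False
      then have "{w. {v, w} \<in> E} = {}" using edge_V by auto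
      then show ?thesis by (simp only: sum.empty)
    qed (simp add: nb3)
    finally show "(\<Sum>u\<in>V. f v u) = 0" .
  qed
  then obtain c where c: "\<And>X Y u v. X \<in> \<F> \<Longrightarrow> Y \<in> \<F> \<Longrightarrow> (u, v) \<in> X \<Longrightarrow> (v, u) \<in> Y \<Longrightarrow> f u v = c X - c Y"
    using face_structure_potential[OF fs] by metis
  define fc where "fc u v = (THE D. D \<in> \<F> \<and> (u, v) \<in> D)" for u v
  have fc_eq: "fc u v = D" if "D \<in> \<F>" "(u, v) \<in> D" for u v D
    unfolding fc_def using that F(5)[of _ D] by (intro the_equality) auto
  have fc: "fc u v \<in> \<F>" "(u, v) \<in> fc u v" if "{u, v} \<in> E" for u v
  proof -
    have "(u, v) \<in> \<Union>\<F>" using that F(2) unfolding edarts_def by simp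
    then obtain D where "D \<in> \<F>" "(u, v) \<in> D" by blast
    then show "fc u v \<in> \<F>" "(u, v) \<in> fc u v" using fc_eq[of D u v] by simp_all
  qed
  have diff: "c (fc u v) = c (fc v u) + 1" if "{u, v} \<in> E" "u \<in> A" for u v
  proof -
    have e: "{v, u} \<in> E" using that(1) by (simp add: insert_commute)
    have "f u v = c (fc u v) - c (fc v u)" using c fc[OF that(1)] fc[OF e] by blast
    then show ?thesis using that unfolding f_def by (simp add: algebra_simps)
  qed
  \<comment> \<open>A face that enters \<open>v\<close> leaves it along another edge; this relates
    the colours of the edges at \<open>v\<close>.\<close>
  have nxt: "\<exists>w. w \<noteq> u \<and> {v, w} \<in> E \<and> fc v w = fc u v" if e: "{u, v} \<in> E" for u v
  proof -
    obtain w where w: "(v, w) \<in> fc u v" "w \<noteq> u" using dcycle_next[OF F(1)[OF fc(1)[OF e]] fc(2)[OF e]] .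
    have "fc u v \<subseteq> edarts" using Union_upper[OF fc(1)[OF e]] F(2) by simp
    then show ?thesis using w fc_eq[OF fc(1)[OF e] w(1)] unfolding edarts_def by blast
  qed
  define col where "col u v = (if u \<in> A then c (fc u v) else c (fc v u))" for u v
  have col_sym: "col u v = col v u" if "{u, v} \<in> E" for u v using bipA[OF that] unfolding col_def by auto
  have step: "\<exists>w. {v, w} \<in> E \<and> col v w = col v x + 1" if vx: "{v, x} \<in> E" for v x
  proof (cases "v \<in> A")
    case False
    have e: "{x, v} \<in> E" using that by (simp add: insert_commute)
    obtain w where w: "{v, w} \<in> E" "fc v w = fc x v" using nxt[OF e] by blast
    have "w \<in> A" using bipA[OF w(1)] False by simp
    then have "c (fc w v) = c (fc v w) + 1" using w(1) by (intro diff) (simp add: insert_commute)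
    then show ?thesis using w False unfolding col_def by auto
  next
    \<comment> \<open>At a vertex of \<open>A\<close> a turn into the next edge lowers the colour by
      one. Two turns are made, which modulo 3 raises it by one.\<close>
    case True
    have *: "\<exists>w. {v, w} \<in> E \<and> col v w + 1 = col v x" if "{v, x} \<in> E" for x
    proof -
      have e: "{x, v} \<in> E" using that by (simp add: insert_commute)
      obtain w where w: "{v, w} \<in> E" "fc v w = fc x v" using nxt[OF e] by blast
      then show ?thesis using True diff[OF that True] unfolding col_def by auto
    qed
    obtain w where w: "{v, w} \<in> E" "col v w + 1 = col v x" using *[OF vx] by blast
    obtain w' where w': "{v, w'} \<in> E" "col v w' + 1 = col v w" using *[OF w(1)] by blast
    have "col v x + 1 = col v w' + 3" using w(2) w'(2) by (simp flip: w(2) w'(2) add: algebra_simps)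
    then show ?thesis using w'(1) by (intro exI[of _ w']) simp
  qed
  have inj: "inj_on (col v) {w. {v, w} \<in> E}" and surj: "col v ` {w. {v, w} \<in> E} = UNIV" if v: "v \<in> V" for v
  proof -
    have "{w. {v, w} \<in> E} \<noteq> {}" using nb3[OF v] by (metis card.empty zero_neq_numeral)
    then obtain x where x: "{v, x} \<in> E" by auto
    obtain y where y: "{v, y} \<in> E" "col v y = col v x + 1" using step[OF x] by blast
    obtain z where z: "{v, z} \<in> E" "col v z = col v y + 1" using step[OF y(1)] by blast
    have "k \<in> {col v x, col v x + 1, col v x + 1 + 1}" for k
      using exhaust_3[of "col v x"] exhaust_3[of k] by auto
    then have "k \<in> col v ` {w. {v, w} \<in> E}" for k using x y z by (metis (mono_tags, lifting) empty_iff imageI insert_iff mem_Collect_eq)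
    then show s: "col v ` {w. {v, w} \<in> E} = UNIV" by auto
    show "inj_on (col v) {w. {v, w} \<in> E}"
      by (rule eq_card_imp_inj_on) (use s nb3[OF v] nbV[of v] finite_V finite_subset in \<open>auto simp: card_UNIV\<close>)
  qed
  define M where "M k v = (THE w. {v, w} \<in> E \<and> col v w = k)" for k v
  have M_eq: "M k v = w" if "{v, w} \<in> E" "col v w = k" for k v w
  proof -
    have "v \<in> V" using edge_V[OF that(1)] by simp
    then show ?thesis unfolding M_def using that inj by (intro the_equality) (auto dest: inj_onD)
  qed
  have M: "{v, M k v} \<in> E" "col v (M k v) = k" if v: "v \<in> V" for k v
  proof -
    have "k \<in> col v ` {w. {v, w} \<in> E}" using surj[OF v] by simp
    then obtain w where "{v, w} \<in> E" "col v w = k" by auto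
    then show "{v, M k v} \<in> E" "col v (M k v) = k" using M_eq by auto
  qed
  have MV: "M k v \<in> V" if "v \<in> V" for k v using edge_V[OF M(1)[OF that]] by simp
  have MM: "M k (M k v) = v" if "v \<in> V" for k v
    using M[OF that, of k] col_sym[of v "M k v"] by (intro M_eq) (simp_all add: insert_commute)
  have MA: "M k v \<in> A \<longleftrightarrow> v \<notin> A" if "v \<in> V" for k v using bipA[OF M(1)[OF that]] by auto
  have E_iff: "{u, v} \<in> E \<longleftrightarrow> u \<in> V \<and> v \<in> {M 0 u, M 1 u, M 2 u}" for u v
  proof
    assume e: "{u, v} \<in> E"
    have "v = M (col u v) u" using M_eq[OF e] by simp
    moreover have "col u v = 0 \<or> col u v = 1 \<or> col u v = 2" using exhaust_3[of "col u v"] by auto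
    ultimately show "u \<in> V \<and> v \<in> {M 0 u, M 1 u, M 2 u}" using edge_V[OF e] by (metis insert_iff)
  qed (use M in auto)
  \<comment> \<open>The dart of the \<open>s\<close>-edge that leaves \<open>A\<close> lies in a
    face of value 1, the reverse dart in a face of value 0.\<close>
  define \<phi>1 where "\<phi>1 v = (if v \<in> A then fc v (M 1 v) else fc (M 1 v) v)" for v
  define \<phi>0 where "\<phi>0 v = (if v \<in> A then fc (M 1 v) v else fc v (M 1 v))" for v
  have c1: "c (\<phi>1 v) = 1" "c (\<phi>0 v) = 0" if v: "v \<in> V" for v
  proof -
    have e: "{v, M 1 v} \<in> E" "{M 1 v, v} \<in> E" using M(1)[OF v, of 1] by (simp_all add: insert_commute)
    show "c (\<phi>1 v) = 1" using M(2)[OF v, of 1] unfolding \<phi>1_def col_def by auto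
    then show "c (\<phi>0 v) = 0" using diff[OF e(1)] diff[OF e(2)] MA[OF v, of 1] unfolding \<phi>1_def \<phi>0_def by (auto split: if_splits)
  qed
  \<comment> \<open>The face of value 0 is followed through \<open>v\<close>: the edge after the
    \<open>s\<close>-edge must have colour 0, and the one after that colour 1 again.\<close>
  have \<phi>0A: "\<phi>0 (M 0 v) = \<phi>0 v" if v: "v \<in> V" "v \<in> A" for v
  proof -
    have "{M 1 v, v} \<in> E" using M(1)[OF v(1), of 1] by (simp add: insert_commute)
    then obtain w where w: "{v, w} \<in> E" "fc v w = fc (M 1 v) v" using nxt by blast
    then have "col v w = 0" using c1(2)[OF v(1)] v(2) unfolding \<phi>0_def col_def by simp
    then have [simp]: "w = M 0 v" using M_eq[OF w(1)] by simp
    obtain x where x: "{M 0 v, x} \<in> E" "fc (M 0 v) x = fc v w" using nxt[OF w(1)] by auto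
    have M0: "M 0 v \<notin> A" "M 0 v \<in> V" using MA MV v by auto
    then have "x \<in> A" using bipA[OF x(1)] by simp
    then have "c (fc x (M 0 v)) = c (fc (M 0 v) x) + 1" using x(1) by (intro diff) (simp add: insert_commute)
    then have "col (M 0 v) x = 1" using M0 x(2) w(2) c1(2)[OF v(1)] v(2) unfolding col_def \<phi>0_def by simp
    then have "M 1 (M 0 v) = x" using M_eq[OF x(1)] by simp
    then show ?thesis using M0 v(2) x(2) w(2) unfolding \<phi>0_def by simp
  qed
  have \<phi>0: "\<phi>0 (M 0 v) = \<phi>0 v" if v: "v \<in> V" for v
    using \<phi>0A[OF v] \<phi>0A[OF MV[OF v], of 0] MA[OF v, of 0] MM[OF v, of 0] by (cases "v \<in> A") simp_all
  have \<phi>1B: "\<phi>1 (M 2 v) = \<phi>1 v" if v: "v \<in> V" "v \<notin> A" for v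
  proof -
    have "{M 1 v, v} \<in> E" using M(1)[OF v(1), of 1] by (simp add: insert_commute)
    then obtain w where w: "{v, w} \<in> E" "fc v w = fc (M 1 v) v" using nxt by blast
    have "w \<in> A" using bipA[OF w(1)] v(2) by simp
    then have "c (fc w v) = c (fc v w) + 1" using w(1) by (intro diff) (simp add: insert_commute)
    then have "col v w = 2" using w(2) c1(1)[OF v(1)] v(2) unfolding col_def \<phi>1_def by simp
    then have [simp]: "w = M 2 v" using M_eq[OF w(1)] by simp
    obtain x where x: "{M 2 v, x} \<in> E" "fc (M 2 v) x = fc v w" using nxt[OF w(1)] by auto
    have M0: "M 2 v \<in> A" "M 2 v \<in> V" using MA MV v by auto
    then have "col (M 2 v) x = 1" using x(2) w(2) c1(1)[OF v(1)] v(2) unfolding col_def \<phi>1_def by simp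
    then have "M 1 (M 2 v) = x" using M_eq[OF x(1)] by simp
    then show ?thesis using M0 v(2) x(2) w(2) unfolding \<phi>1_def by simp
  qed
  have \<phi>1: "\<phi>1 (M 2 v) = \<phi>1 v" if v: "v \<in> V" for v
    using \<phi>1B[OF v] \<phi>1B[OF MV[OF v], of 2] MA[OF v, of 2] MM[OF v, of 2] by (cases "v \<in> A") simp_all
  have edarts_eq: "{(v, w). v \<in> V \<and> w \<in> {M 0 v, M 1 v, M 2 v}} = edarts"
    unfolding edarts_def E_iff by auto
  have "tricoloured V A (M 0) (M 1) (M 2) \<phi>0 \<phi>1"
  proof
    show "finite V" by (rule finite_V)
    fix v assume v: "v \<in> V"
    show "M 0 v \<in> V" "M 1 v \<in> V" "M 2 v \<in> V" using MV[OF v] by simp_all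
    show "M 0 (M 0 v) = v" "M 1 (M 1 v) = v" "M 2 (M 2 v) = v" using MM[OF v] by simp_all
    show "M 0 v \<in> A \<longleftrightarrow> v \<notin> A" "M 1 v \<in> A \<longleftrightarrow> v \<notin> A" "M 2 v \<in> A \<longleftrightarrow> v \<notin> A" using MA[OF v] by simp_all
    have "M k v \<noteq> M l v" if "k \<noteq> l" for k l using M(2)[OF v] that by metis
    then show "M 0 v \<noteq> M 1 v" "M 0 v \<noteq> M 2 v" "M 1 v \<noteq> M 2 v" by simp_all
    show "\<phi>0 (M 0 v) = \<phi>0 v" by (rule \<phi>0[OF v])
    show "\<phi>1 (M 2 v) = \<phi>1 v" by (rule \<phi>1[OF v])
    show "\<phi>0 (M 1 v) = \<phi>0 v" "\<phi>1 (M 1 v) = \<phi>1 v"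
      using MA[OF v, of 1] MM[OF v, of 1] unfolding \<phi>0_def \<phi>1_def by auto
    fix w assume w: "w \<in> V"
    have "(adj E)\<^sup>*\<^sup>* v w" using conn v w unfolding connected_graph_def by blast
    then show "(\<lambda>x y. y \<in> {M 0 x, M 1 x, M 2 x})\<^sup>*\<^sup>* v w"
      by (rule rtranclp_mono[THEN predicate2D, rotated]) (auto simp: adj_def E_iff)
  next
    fix g :: "'a \<Rightarrow> 'a \<Rightarrow> 3" assume "flow V {(v, w). v \<in> V \<and> w \<in> {M 0 v, M 1 v, M 2 v}} g"
    then have "flow V edarts g" unfolding edarts_eq .
    then obtain c' where c': "\<And>X Y u v. X \<in> \<F> \<Longrightarrow> Y \<in> \<F> \<Longrightarrow> (u, v) \<in> X \<Longrightarrow> (v, u) \<in> Y \<Longrightarrow> g u v = c' X - c' Y"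
      using face_structure_potential[OF fs] by metis
    have "g v (M 1 v) = c' (\<phi>1 v) - c' (\<phi>0 v)" if v: "v \<in> V" "v \<in> A" for v
    proof -
      have e: "{v, M 1 v} \<in> E" "{M 1 v, v} \<in> E" using M(1)[OF v(1), of 1] by (simp_all add: insert_commute)
      show ?thesis using c'[OF fc(1)[OF e(1)] fc(1)[OF e(2)] fc(2)[OF e(1)] fc(2)[OF e(2)]] v(2) unfolding \<phi>0_def \<phi>1_def by simp
    qed
    then show "\<exists>c. \<forall>v\<in>V \<inter> A. g v (M 1 v) = c (\<phi>1 v) - c (\<phi>0 v)" by blast
  qed
  then show ?thesis using E_iff by blast
qed

end

section \<open>Vertex orders\<close>

fun before :: "'a list \<Rightarrow> 'a \<Rightarrow> 'a \<Rightarrow> bool" where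
  "before [] x y \<longleftrightarrow> False"
| "before (z # L) x y \<longleftrightarrow> x = z \<and> y \<in> set L \<or> before L x y"

lemma before_in_set: "before L x y \<Longrightarrow> x \<in> set L \<and> y \<in> set L"
  by (induction L) auto

lemma before_append: "before (P @ Q) x y \<longleftrightarrow> before P x y \<or> before Q x y \<or> x \<in> set P \<and> y \<in> set Q"
  by (induction P) (auto dest: before_in_set)

lemma before_irrefl: "distinct L \<Longrightarrow> \<not> before L x x"
  by (induction L) (auto dest: before_in_set)

lemma before_trans: "distinct L \<Longrightarrow> before L x y \<Longrightarrow> before L y z \<Longrightarrow> before L x z"
  by (induction L) (auto dest: before_in_set)

lemma before_last: "distinct L \<Longrightarrow> \<not> before L (last L) y"
  by (induction L) (auto dest: before_in_set)

lemma before_nth: "i < j \<Longrightarrow> j < length L \<Longrightarrow> before L (L ! i) (L ! j)"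
  by (induction L arbitrary: i j) (auto simp: nth_Cons split: nat.splits)

lemma darts_split: "(x, y) \<in> darts L \<Longrightarrow> \<exists>us vs. L = us @ x # y # vs"
proof (induction L rule: darts.induct)
  case (1 a b zs)
  show ?case
  proof (cases "(x, y) = (a, b)")
    case True
    then show ?thesis by (intro exI[of _ "[]"] exI[of _ zs]) simp
  next
    case False
    then obtain us vs where "b # zs = us @ x # y # vs" using 1 by auto
    then show ?thesis by (intro exI[of _ "a # us"] exI[of _ vs]) simp
  qed
qed auto

lemma darts_before: "(x, y) \<in> darts L \<Longrightarrow> before L x y"
  using darts_split[of x y L] by (auto simp: before_append)

lemma darts_no_between: "distinct L \<Longrightarrow> (x, y) \<in> darts L \<Longrightarrow> \<not> (before L x c \<and> before L c y)"
  using darts_split[of x y L] by (auto simp: before_append dest: before_in_set)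

lemma darts_append_all:
  "darts (xs @ ys) = darts xs \<union> darts ys \<union> (if xs \<noteq> [] \<and> ys \<noteq> [] then {(last xs, hd ys)} else {})"
proof (induction xs rule: darts.induct)
  case ("2_2" v)
  then show ?case by (cases ys) auto
qed auto

lemma darts_successor: "z \<in> set C \<Longrightarrow> z \<noteq> last C \<Longrightarrow> \<exists>y. (z, y) \<in> darts C"
  by (induction C rule: darts.induct) auto

text \<open>For an involution \<open>f\<close> every crossing is of this shape once each edge is
  named by its left end.\<close>

definition noncrossing :: "('a \<Rightarrow> 'a) \<Rightarrow> 'a list \<Rightarrow> bool" where
  "noncrossing f L \<longleftrightarrow> (\<forall>a c. \<not> (before L a c \<and> before L c (f a) \<and> before L (f a) (f c)))"

text \<open>An edge has both ends in the inserted block or none, since the block is closed under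
  \<open>f\<close>. The block is contiguous, so an edge within it cannot cross an edge outside
  it.\<close>

lemma noncrossing_insert:
  assumes "noncrossing f (P @ Q)" "noncrossing f C" "f ` set C \<subseteq> set C"
    "f ` set (P @ Q) \<subseteq> set (P @ Q)" "distinct (P @ C @ Q)"
  shows "noncrossing f (P @ C @ Q)"
  unfolding noncrossing_def
proof (intro allI notI, elim conjE)
  fix a c
  let ?L = "P @ C @ Q"
  assume h: "before ?L a c" "before ?L c (f a)" "before ?L (f a) (f c)"
  have inn: "before C x y" if "before ?L x y" "x \<in> set C" "y \<in> set C" for x y
    using that assms(5) by (auto simp: before_append dest: before_in_set)
  have outt: "before (P @ Q) x y" if "before ?L x y" "x \<notin> set C" "y \<notin> set C" for x y
    using that by (auto simp: before_append dest: before_in_set)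
  have CQ: "y \<in> set Q" if "before ?L x y" "x \<in> set C" "y \<notin> set C" for x y
    using that assms(5) by (auto simp: before_append dest: before_in_set)
  have QC: "y \<notin> set C" if "before ?L x y" "x \<in> set Q" for x y
    using that assms(5) by (auto simp: before_append dest: before_in_set)
  have mem: "a \<in> set ?L" "c \<in> set ?L" using before_in_set[OF h(1)] by auto
  have cls: "f x \<in> set C \<longleftrightarrow> x \<in> set C" if "x \<in> set ?L" for x
    using that assms(3-5) by (auto simp: image_subset_iff)
  show False
  proof (cases "a \<in> set C"; cases "c \<in> set C")
    assume "a \<in> set C" "c \<in> set C"
    then show False using inn[OF h(1)] inn[OF h(2)] inn[OF h(3)] cls mem assms(2) unfolding noncrossing_def by blast
  next
    assume "a \<in> set C" "c \<notin> set C"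
    then show False using CQ[OF h(1)] QC[OF h(2)] cls[OF mem(1)] by blast
  next
    assume "a \<notin> set C" "c \<in> set C"
    then show False using CQ[OF h(2)] QC[OF h(3)] cls[OF mem(1)] cls[OF mem(2)] by blast
  next
    assume "a \<notin> set C" "c \<notin> set C"
    then show False using outt[OF h(1)] outt[OF h(2)] outt[OF h(3)] cls mem assms(1) unfolding noncrossing_def by blast
  qed
qed

section \<open>Orders composed of the faces bounded by \<open>m\<close>- and
  \<open>t\<close>-edges\<close>

context tricoloured
begin

text \<open>An order is stored as the list of its \<open>m\<close>-edges, each given by its end in
  \<open>A\<close>. So the \<open>m\<close>-edges join neighbours by construction, and the vertices
  alternate between \<open>A\<close> and its complement.\<close>

definition seq :: "'a list \<Rightarrow> 'a list" where "seq B = concat (map (\<lambda>b. [b, m b]) B)"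

lemma seq_simps: "seq [] = []" "seq (b # B) = b # m b # seq B" "seq (B @ C) = seq B @ seq C"
  unfolding seq_def by simp_all

lemma set_seq: "set (seq B) = set B \<union> m ` set B"
  by (induction B) (auto simp: seq_simps)

lemma last_seq: "B \<noteq> [] \<Longrightarrow> last (seq B) = m (last B)"
  using seq_simps(3)[of "butlast B" "[last B]"] by (simp add: seq_simps(1,2))

lemma darts_seq: "darts (seq B) = (\<lambda>b. (b, m b)) ` set B \<union> (\<lambda>(b, b'). (m b, b')) ` darts B"
  by (induction B rule: darts.induct) (auto simp: seq_simps)

lemma distinct_seq:
  assumes "distinct B" "set B \<subseteq> V \<inter> A"
  shows "distinct (seq B)"
  using assms
proof (induction B)
  case (Cons b B)
  have "m b \<notin> A" using Cons.prems inA by auto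
  moreover have "x \<in> V" if "x \<in> set B" for x using that Cons.prems by auto
  then have "m b \<notin> m ` set B" using Cons.prems inv(1) by (metis distinct.simps(2) imageE Int_iff insert_subset list.simps(15))
  moreover have "b \<notin> m ` set B"
  proof
    assume "b \<in> m ` set B"
    then obtain x where "x \<in> set B" "b = m x" by auto
    then show False using Cons.prems inA(1)[of x] by auto
  qed
  moreover have "distinct (seq B)" using Cons by simp
  ultimately show ?case using Cons.prems by (auto simp: seq_simps set_seq)
qed (simp add: seq_simps)

text \<open>A face bounded by \<open>m\<close>- and \<open>t\<close>-edges, given by the ends in \<open>A\<close> of its \<open>m\<close>-edges.\<close>

definition tour :: "'a list \<Rightarrow> bool" where
  "tour C \<longleftrightarrow> C \<noteq> [] \<and> distinct C \<and> set C \<subseteq> V \<inter> A \<and> darts C \<subseteq> {(x, y). y = t (m x)} \<and> t (m (last C)) = hd C"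

lemma tm_VA: "x \<in> V \<inter> A \<Longrightarrow> t (m x) \<in> V \<inter> A"
  using inV inA by auto

lemma tm_inj: "x \<in> V \<Longrightarrow> y \<in> V \<Longrightarrow> t (m x) = t (m y) \<Longrightarrow> x = y"
  using inv inV by metis

text \<open>A longest list following the map that sends x to \<open>t (m x)\<close> must run back
  into itself, and since the map is injective it can do so only at its head
  \<open>q\<close>.\<close>

lemma exists_tour:
  assumes "q \<in> V \<inter> A"
  obtains C where "tour C" "hd C = q"
proof -
  let ?P = "\<lambda>C. C \<noteq> [] \<and> distinct C \<and> set C \<subseteq> V \<inter> A \<and> darts C \<subseteq> {(x, y). y = t (m x)} \<and> hd C = q"
  have bound: "length C \<le> card V" if "?P C" for C
    using that fin by (metis card_mono distinct_card le_inf_iff)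
  define P where "P = ?P"
  have "P [q]" "\<forall>C. P C \<longrightarrow> length C < Suc (card V)"
    using assms bound unfolding P_def by (simp, auto simp: less_Suc_eq_le)
  from ex_has_greatest_nat[OF this]
  obtain C where "P C" and "\<forall>C'. P C' \<longrightarrow> length C' \<le> length C" by blast
  then have C: "?P C" and max: "\<And>C'. ?P C' \<Longrightarrow> length C' \<le> length C" unfolding P_def by blast+
  let ?z = "last C"
  have zV: "?z \<in> V \<inter> A" "?z \<in> set C" using C by auto
  have in_C: "t (m ?z) \<in> set C"
  proof (rule ccontr)
    assume n: "t (m ?z) \<notin> set C"
    have "?P (C @ [t (m ?z)])" using C n tm_VA[OF zV(1)] by (auto simp: darts_append_all)
    then show False using max[of "C @ [t (m ?z)]"] by simp
  qed
  have "t (m ?z) = q"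
  proof (rule ccontr)
    assume nq: "t (m ?z) \<noteq> q"
    define z y where "z = last C" and "y = t (m z)"
    then have "y \<in> set C" "y \<noteq> hd C" "z \<in> set C" using in_C nq C zV(2) by simp_all
    then obtain us vs where uv: "C = us @ y # vs" by (meson split_list)
    have "us \<noteq> []" using uv \<open>y \<noteq> hd C\<close> by auto
    then have "(last us, y) \<in> darts C" unfolding uv by (simp add: darts_append_all)
    then have "t (m z) = t (m (last us))" using C \<open>y = t (m z)\<close> by auto
    moreover have "last us \<in> set us" using \<open>us \<noteq> []\<close> by simp
    ultimately have "z \<in> set us" using tm_inj[of z "last us"] \<open>z \<in> set C\<close> C uv by auto
    moreover have "z \<in> set (y # vs)" unfolding \<open>z = last C\<close> uv by simp
    ultimately show False using C uv by (metis disjoint_iff distinct_append)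
  qed
  then show ?thesis using that[of C] C unfolding tour_def by simp
qed

lemma tour_pred:
  assumes "tour C" "b \<in> set C"
  obtains z where "z \<in> set C" "b = t (m z)"
proof -
  have C: "C \<noteq> []" "distinct C" "set C \<subseteq> V \<inter> A" "darts C \<subseteq> {(x, y). y = t (m x)}" "t (m (last C)) = hd C"
    using assms(1) unfolding tour_def by auto
  have "(\<lambda>x. t (m x)) ` set C \<subseteq> set C"
  proof
    fix y assume "y \<in> (\<lambda>x. t (m x)) ` set C"
    then obtain x where x: "x \<in> set C" "y = t (m x)" by auto
    show "y \<in> set C"
    proof (cases "x = last C")
      case True
      then show ?thesis using x C by simp
    next
      case False
      then obtain y' where "(x, y') \<in> darts C" using darts_successor x by metis
      then show ?thesis using x C(4) darts_in_set' by fastforce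
    qed
  qed
  moreover have "inj_on (\<lambda>x. t (m x)) (set C)" using C(3) tm_inj by (auto simp: inj_on_def)
  ultimately have "(\<lambda>x. t (m x)) ` set C = set C" by (simp add: endo_inj_surj)
  then show ?thesis using assms(2) that by auto
qed

lemma tour_succ:
  assumes "tour C" "x \<in> set C"
  shows "t (m x) \<in> set C" "x \<noteq> last C \<Longrightarrow> (x, t (m x)) \<in> darts C"
proof -
  have C: "C \<noteq> []" "darts C \<subseteq> {(x, y). y = t (m x)}" "t (m (last C)) = hd C"
    using assms(1) unfolding tour_def by auto
  show d: "(x, t (m x)) \<in> darts C" if "x \<noteq> last C"
    using darts_successor[OF assms(2) that] C(2) by auto
  show "t (m x) \<in> set C"
    using d darts_in_set'[of x "t (m x)" C] C by (cases "x = last C") auto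
qed

lemma tour_closed: assumes "tour C" shows "t ` set (seq C) \<subseteq> set (seq C)"
proof
  fix y assume "y \<in> t ` set (seq C)"
  then obtain x where x: "x \<in> set (seq C)" "y = t x" by auto
  have CV: "set C \<subseteq> V" using assms unfolding tour_def by auto
  from x(1) consider "x \<in> set C" | z where "z \<in> set C" "x = m z" unfolding set_seq by auto
  then show "y \<in> set (seq C)"
  proof cases
    case 1
    then obtain z where z: "z \<in> set C" "x = t (m z)" using tour_pred[OF assms] by metis
    then have "y = m z" using x(2) inv(3)[of "m z"] inV(1)[of z] CV by auto
    then show ?thesis using z unfolding set_seq by simp
  next
    case 2
    then show ?thesis using x(2) tour_succ(1)[OF assms] unfolding set_seq by simp
  qed
qed

text \<open>A \<open>t\<close>-edge joins neighbours in \<open>seq C\<close>, except for the one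
  between the last vertex and the first, which encloses all others.\<close>

lemma tour_noncrossing: assumes "tour C" shows "noncrossing t (seq C)"
  unfolding noncrossing_def
proof (intro allI notI, elim conjE)
  fix a c
  let ?L = "seq C"
  assume h: "before ?L a c" "before ?L c (t a)" "before ?L (t a) (t c)"
  have C: "C \<noteq> []" "distinct C" "set C \<subseteq> V \<inter> A" "t (m (last C)) = hd C"
    using assms unfolding tour_def by auto
  have dL: "distinct ?L" using distinct_seq C by simp
  have aL: "a \<in> set ?L" using before_in_set[OF h(1)] by simp
  have lastL: "last ?L = m (last C)" using last_seq[OF C(1)] .
  from aL consider "a \<in> set C" | z where "z \<in> set C" "a = m z" unfolding set_seq by auto
  then show False
  proof cases
    case 1
    then obtain z where z: "z \<in> set C" "a = t (m z)" using tour_pred[OF assms] by metis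
    have ta: "t a = m z" using z inv(3)[of "m z"] inV(1)[of z] C(3) by auto
    show False
    proof (cases "z = last C")
      case True
      then show False using h(3) ta lastL before_last[OF dL] by metis
    next
      case False
      then have "(m z, a) \<in> darts ?L" using tour_succ(2)[OF assms z(1)] z(2) unfolding darts_seq by force
      then have "before ?L (t a) a" using darts_before ta by metis
      then show False using before_trans[OF dL] before_irrefl[OF dL] h(1,2) by metis
    qed
  next
    case 2
    show False
    proof (cases "z = last C")
      case True
      then show False using h(1) 2(2) lastL before_last[OF dL] by metis
    next
      case False
      then have "(a, t a) \<in> darts ?L" using tour_succ(2)[OF assms 2(1)] 2(2) unfolding darts_seq by force
      then show False using darts_no_between[OF dL] h(1,2) by metis
    qed
  qed
qed

definition step :: "'a list \<Rightarrow> 'a \<Rightarrow> 'a \<Rightarrow> bool" where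
  "step L x y \<longleftrightarrow> x \<in> V \<and> (y = m x \<or> y = t x \<or> y = s x \<and> ((x, y) \<in> darts L \<or> (y, x) \<in> darts L))"

lemma step_sym: "step L x y \<Longrightarrow> step L y x"
  unfolding step_def using inv inV by metis

lemma steps_sym: "(step L)\<^sup>*\<^sup>* x y \<Longrightarrow> (step L)\<^sup>*\<^sup>* y x"
  by (induction rule: rtranclp_induct) (auto intro: step_sym converse_rtranclp_into_rtranclp)

lemma tour_connected:
  assumes "tour C" "x \<in> set (seq C)"
  shows "(step L)\<^sup>*\<^sup>* (hd C) x"
proof -
  have C: "C \<noteq> []" "set C \<subseteq> V \<inter> A" "darts C \<subseteq> {(x, y). y = t (m x)}"
    using assms(1) unfolding tour_def by auto
  have m_step: "(step L)\<^sup>*\<^sup>* b (m b)" if "b \<in> V" for b using that unfolding step_def by blast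
  have *: "(step L)\<^sup>*\<^sup>* (hd C) b" if "b \<in> set C" for b
    using that C
  proof (induction C rule: darts.induct)
    case (1 u v zs)
    have "v = t (m u)" "u \<in> V" using 1 by auto
    then have "step L u (m u)" "step L (m u) v" using inV(1) unfolding step_def by auto
    then have uv: "(step L)\<^sup>*\<^sup>* u v" by (meson converse_rtranclp_into_rtranclp rtranclp.rtrancl_refl)
    show ?case
    proof (cases "b = u")
      case False
      then have "(step L)\<^sup>*\<^sup>* v b" using 1 by auto
      then show ?thesis using uv by (simp add: rtranclp_trans)
    qed simp
  qed auto
  from assms(2) consider "x \<in> set C" | b where "b \<in> set C" "x = m b" unfolding set_seq by auto
  then show ?thesis
  proof cases
    case 2
    then show ?thesis using *[of b] m_step[of b] C(2) by (meson Int_iff rtranclp_trans subsetD)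
  qed (rule *)
qed

text \<open>The condition on \<open>\<phi>1\<close> puts the two vertices at every gap between
  successive \<open>m\<close>-edges on a common face, so that a dual walk can pass the gap. The last
  condition supplies the paths from which flows are made in \<open>noncrossing_s\<close>.\<close>

definition layout :: "'a list \<Rightarrow> bool" where
  "layout B \<longleftrightarrow> distinct B \<and> set B \<subseteq> V \<inter> A \<and> t ` set (seq B) \<subseteq> set (seq B) \<and>
     (\<forall>(b, b') \<in> darts B. \<phi>1 (m b) = \<phi>1 b') \<and> noncrossing t (seq B) \<and>
     (\<forall>u\<in>set (seq B). \<forall>v\<in>set (seq B). (step (seq B))\<^sup>*\<^sup>* u v)"

lemma layout_tour:
  assumes "tour C" shows "layout C"
proof -
  have C: "distinct C" "set C \<subseteq> V \<inter> A" "darts C \<subseteq> {(x, y). y = t (m x)}"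
    using assms(1) unfolding tour_def by auto
  have "\<phi>1 (m b) = \<phi>1 b'" if "(b, b') \<in> darts C" for b b'
  proof -
    have "b \<in> V" "b' = t (m b)" using that C darts_in_set'[of b b' C] by auto
    then show ?thesis using faces(4)[of "m b"] inV(1) by simp
  qed
  moreover have "(step (seq C))\<^sup>*\<^sup>* u v" if "u \<in> set (seq C)" "v \<in> set (seq C)" for u v
    using tour_connected[OF assms that(1), of "seq C"] tour_connected[OF assms that(2), of "seq C"]
    by (meson steps_sym rtranclp_trans)
  ultimately show ?thesis
    unfolding layout_def using C tour_closed[OF assms] tour_noncrossing[OF assms] by auto
qed

text \<open>The \<open>t\<close>-edge between the last and the first vertex of the block puts both
  on one face \<open>\<phi>1\<close>; filling a gap on this face therefore leaves gaps on it. The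
  hypothesis \<open>broken\<close> demands that the two vertices torn apart are not joined by an
  \<open>s\<close>-edge, so that all old steps survive, and \<open>link\<close> supplies the step to
  the new block.\<close>

lemma layout_insert:
  assumes lay: "layout (B1 @ B2)" and C: "tour C" and disj: "set (seq C) \<inter> set (seq (B1 @ B2)) = {}"
    and left: "B1 \<noteq> [] \<Longrightarrow> \<phi>1 (m (last B1)) = \<phi>1 (hd C)" and right: "B2 \<noteq> [] \<Longrightarrow> \<phi>1 (hd C) = \<phi>1 (hd B2)"
    and broken: "B1 \<noteq> [] \<Longrightarrow> B2 \<noteq> [] \<Longrightarrow> s (m (last B1)) \<noteq> hd B2"
    and link: "p \<in> set (seq (B1 @ B2))" "s p \<in> set (seq C)"
      "(p, s p) \<in> darts (seq (B1 @ C @ B2)) \<or> (s p, p) \<in> darts (seq (B1 @ C @ B2))"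
  shows "layout (B1 @ C @ B2)"
proof -
  let ?L = "seq (B1 @ B2)" and ?L' = "seq (B1 @ C @ B2)"
  have B: "distinct (B1 @ B2)" "set (B1 @ B2) \<subseteq> V \<inter> A" "t ` set ?L \<subseteq> set ?L"
    "\<And>b b'. (b, b') \<in> darts (B1 @ B2) \<Longrightarrow> \<phi>1 (m b) = \<phi>1 b'" "noncrossing t ?L"
    "\<And>u v. u \<in> set ?L \<Longrightarrow> v \<in> set ?L \<Longrightarrow> (step ?L)\<^sup>*\<^sup>* u v"
    using lay unfolding layout_def by auto
  have C': "C \<noteq> []" "distinct C" "set C \<subseteq> V \<inter> A" "darts C \<subseteq> {(x, y). y = t (m x)}" "t (m (last C)) = hd C"
    using C unfolding tour_def by auto
  note LC = layout_tour[OF C]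
  have d: "distinct (B1 @ C @ B2)" "set (B1 @ C @ B2) \<subseteq> V \<inter> A"
    using B(1,2) C'(2,3) disj unfolding set_seq by auto
  have dL: "distinct ?L'" using distinct_seq[OF d] .
  have setL': "set ?L' = set ?L \<union> set (seq C)" unfolding seq_simps by auto
  have 1: "t ` set ?L' \<subseteq> set ?L'" using B(3) tour_closed[OF C] unfolding setL' by auto
  have lastC: "\<phi>1 (m (last C)) = \<phi>1 (hd C)"
    using faces(4)[of "m (last C)"] inV(1)[of "last C"] C' by (metis Int_iff last_in_set subsetD)
  have 2: "\<phi>1 (m b) = \<phi>1 b'" if "(b, b') \<in> darts (B1 @ C @ B2)" for b b'
  proof -
    have "(b, b') \<in> darts (B1 @ B2) \<or> (b, b') \<in> darts C \<or> B1 \<noteq> [] \<and> (b, b') = (last B1, hd C) \<or>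
        B2 \<noteq> [] \<and> (b, b') = (last C, hd B2)"
      using that C'(1) by (auto simp: darts_append_all split: if_splits)
    moreover have "\<phi>1 (m b) = \<phi>1 b'" if "(b, b') \<in> darts C" using LC that unfolding layout_def by auto
    ultimately show ?thesis using B(4) left right lastC by auto
  qed
  have 3: "noncrossing t ?L'"
    unfolding seq_simps
    by (rule noncrossing_insert) (use B(3,5) tour_noncrossing[OF C] tour_closed[OF C] dL in \<open>simp_all add: seq_simps\<close>)
  have mono: "step ?L' x y" if "step ?L x y" for x y
  proof -
    \<comment> \<open>The insertion destroys only the adjacency across the opened gap.\<close>
    have *: "(x, y) \<in> darts ?L'" if "(x, y) \<in> darts ?L" "s x = y" for x y
    proof (rule ccontr)
      assume n: "(x, y) \<notin> darts ?L'"
      have "B1 \<noteq> [] \<and> B2 \<noteq> [] \<and> x = m (last B1) \<and> y = hd B2"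
        using that(1) n C'(1) unfolding darts_seq by (auto simp: darts_append_all split: if_splits)
      then show False using broken that(2) by auto
    qed
    show ?thesis using that *[of x y] *[of y x] inv(2) unfolding step_def by auto
  qed
  have old: "(step ?L')\<^sup>*\<^sup>* u v" if "u \<in> set ?L" "v \<in> set ?L" for u v
    using B(6)[OF that] mono by (metis mono_rtranclp)
  have new: "(step ?L')\<^sup>*\<^sup>* (hd C) v" if "v \<in> set (seq C)" for v using tour_connected[OF C that] .
  have "set ?L \<subseteq> V" using B(2) inV(1) unfolding set_seq by auto
  then have pstep: "step ?L' p (s p)" using link unfolding step_def by auto
  have hdC: "(step ?L')\<^sup>*\<^sup>* p v" if "v \<in> set ?L'" for v
  proof (cases "v \<in> set ?L")
    case False
    then have "(step ?L')\<^sup>*\<^sup>* (hd C) v" using that new setL' by auto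
    moreover have "(step ?L')\<^sup>*\<^sup>* (s p) (hd C)" using steps_sym[OF new[OF link(2)]] .
    ultimately show ?thesis using pstep by (meson converse_rtranclp_into_rtranclp rtranclp_trans)
  qed (use old link in auto)
  then have "(step ?L')\<^sup>*\<^sup>* u v" if "u \<in> set ?L'" "v \<in> set ?L'" for u v
    using that by (meson steps_sym rtranclp_trans)
  then show ?thesis unfolding layout_def using d 1 2 3 by auto
qed

text \<open>The tour through \<open>s p\<close> is turned so that \<open>s p\<close> becomes a
  neighbour of \<open>p\<close>. If \<open>p\<close> ends its \<open>m\<close>-edge, the tour starts
  with \<open>s p\<close> and is put after \<open>p\<close>; if \<open>p\<close> begins its
  \<open>m\<close>-edge, the tour must end with \<open>s p\<close>, hence start with
  \<open>t (s p)\<close>, and is put before \<open>p\<close>. The \<open>s\<close>-edge places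
  \<open>s p\<close> on the face \<open>\<phi>1 p\<close>, which is the face of the gap.\<close>

lemma layout_extend:
  assumes lay: "layout B" and p: "p \<in> set (seq B)" "s p \<notin> set (seq B)"
  shows "\<exists>B'. layout B' \<and> set (seq B) \<subset> set (seq B')"
proof -
  have BV: "set B \<subseteq> V \<inter> A" and dB: "distinct B" and tB: "t ` set (seq B) \<subseteq> set (seq B)"
    and J: "\<And>b b'. (b, b') \<in> darts B \<Longrightarrow> \<phi>1 (m b) = \<phi>1 b'"
    using lay unfolding layout_def by auto
  have mB: "m ` set (seq B) \<subseteq> set (seq B)" using BV inv(1) unfolding set_seq by auto
  have WV: "set (seq B) \<subseteq> V" using BV inV(1) unfolding set_seq by auto
  have pV: "p \<in> V" "s p \<in> V" "s (s p) = p" using p WV inV inv by auto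
  have dis: "set (seq C) \<inter> set (seq B) = {}" if C: "tour C" "s p \<in> set (seq C)" for C
  proof (rule ccontr)
    assume "\<not> ?thesis"
    then obtain x where x: "x \<in> set (seq C)" "x \<in> set (seq B)" by auto
    \<comment> \<open>For the empty order \<open>step\<close> allows only \<open>m\<close>- and
      \<open>t\<close>-edges. The layout is closed under these, so a tour that meets it would lie in
      it.\<close>
    have "(step [])\<^sup>*\<^sup>* x (s p)"
      using tour_connected[OF C(1) x(1)] tour_connected[OF C] by (meson steps_sym rtranclp_trans)
    then have "s p \<in> set (seq B)"
      by (induction rule: rtranclp_induct) (use x mB tB in \<open>auto simp: step_def\<close>)
    then show False using p by simp
  qed
  show ?thesis
  proof (cases "p \<in> A")
    case False
    then obtain b where b: "b \<in> set B" "p = m b" using p(1) BV unfolding set_seq by auto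
    obtain B1 B2 where B: "B = B1 @ b # B2" using b(1) by (meson split_list)
    have qA: "s p \<in> V \<inter> A" using pV inA False by auto
    obtain C where C: "tour C" "hd C = s p" using exists_tour[OF qA] .
    have C0: "C \<noteq> []" using C(1) unfolding tour_def by simp
    have inC: "s p \<in> set (seq C)" using C(2) hd_in_set[OF C0] unfolding set_seq by simp
    have "layout ((B1 @ [b]) @ C @ B2)"
    proof (rule layout_insert)
      show "layout ((B1 @ [b]) @ B2)" using lay B by simp
      show "tour C" by fact
      show "set (seq C) \<inter> set (seq ((B1 @ [b]) @ B2)) = {}" using dis[OF C(1) inC] B by simp
      show "\<phi>1 (m (last (B1 @ [b]))) = \<phi>1 (hd C)" using b(2) C(2) faces(3)[OF pV(1)] by simp
      show "\<phi>1 (hd C) = \<phi>1 (hd B2)" if "B2 \<noteq> []"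
      proof -
        have "(b, hd B2) \<in> darts B" using that B by (simp add: darts_append_all neq_Nil_conv) (cases B2; auto)
        then show ?thesis using J b(2) C(2) faces(3)[OF pV(1)] by simp
      qed
      show "s (m (last (B1 @ [b]))) \<noteq> hd B2" if "B2 \<noteq> []"
      proof -
        have "hd B2 \<in> set (seq B)" using that B unfolding set_seq by auto
        then show ?thesis using p(2) b(2) by auto
      qed
      show "p \<in> set (seq ((B1 @ [b]) @ B2))" using p B by simp
      show "s p \<in> set (seq C)" by fact
      have "(b, hd C) \<in> darts ((B1 @ [b]) @ C @ B2)" using C0 by (simp add: darts_append_all) (cases C; auto)
      then have "(m b, hd C) \<in> darts (seq ((B1 @ [b]) @ C @ B2))" unfolding darts_seq by force
      then show "(p, s p) \<in> darts (seq ((B1 @ [b]) @ C @ B2)) \<or> (s p, p) \<in> darts (seq ((B1 @ [b]) @ C @ B2))"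
        using b(2) C(2) by simp
    qed
    moreover have "set (seq B) \<subset> set (seq ((B1 @ [b]) @ C @ B2))" using B inC p(2) by (auto simp: seq_simps)
    ultimately show ?thesis by blast
  next
    case True
    then have "p \<notin> m ` set B" using BV inA(1) by auto
    then have pB: "p \<in> set B" using p(1) unfolding set_seq by auto
    obtain B1 B2 where B: "B = B1 @ p # B2" using pB by (meson split_list)
    have qA: "t (s p) \<in> V \<inter> A" using pV inA True inV by auto
    obtain C where C: "tour C" "hd C = t (s p)" using exists_tour[OF qA] .
    have C0: "C \<noteq> []" "t (m (last C)) = hd C" "set C \<subseteq> V" using C(1) unfolding tour_def by auto
    have "last C \<in> V" using C0(1,3) last_in_set by blast
    then have "t (t (m (last C))) = m (last C)" using inv(3) inV(1) by blast
    then have lastC: "m (last C) = s p" using C0(2) C(2) inv(3)[OF pV(2)] by simp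
    have inC: "s p \<in> set (seq C)" using lastC C0(1) unfolding set_seq by (metis UnI2 imageI last_in_set)
    have \<phi>: "\<phi>1 (hd C) = \<phi>1 p" using C(2) faces(4)[OF pV(2)] faces(3)[OF pV(1)] by simp
    have "layout (B1 @ C @ (p # B2))"
    proof (rule layout_insert)
      show "layout (B1 @ (p # B2))" using lay B by simp
      show "tour C" by fact
      show "set (seq C) \<inter> set (seq (B1 @ (p # B2))) = {}" using dis[OF C(1) inC] B by simp
      show "\<phi>1 (hd C) = \<phi>1 (hd (p # B2))" using \<phi> by simp
      show "\<phi>1 (m (last B1)) = \<phi>1 (hd C)" if "B1 \<noteq> []"
      proof -
        have "(last B1, p) \<in> darts B" using that B by (simp add: darts_append_all)
        then show ?thesis using J \<phi> by simp
      qed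
      show "s (m (last B1)) \<noteq> hd (p # B2)" if "B1 \<noteq> []"
      proof
        assume eq: "s (m (last B1)) = hd (p # B2)"
        have l: "last B1 \<in> set B" using that B by simp
        then have "m (last B1) \<in> V" using BV inV(1) by auto
        then have "m (last B1) = s p" using eq inv(2)[of "m (last B1)"] by simp
        then show False using imageI[OF l, of m] p(2) unfolding set_seq by simp
      qed
      show "p \<in> set (seq (B1 @ (p # B2)))" using p B by simp
      show "s p \<in> set (seq C)" by fact
      have "(last C, p) \<in> darts (B1 @ C @ (p # B2))" using C0 by (simp add: darts_append_all)
      then have "(m (last C), p) \<in> darts (seq (B1 @ C @ (p # B2)))" unfolding darts_seq by force
      then show "(p, s p) \<in> darts (seq (B1 @ C @ (p # B2))) \<or> (s p, p) \<in> darts (seq (B1 @ C @ (p # B2)))"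
        using lastC by simp
    qed
    moreover have "set (seq B) \<subset> set (seq (B1 @ C @ (p # B2)))" using B inC p(2) by (auto simp: seq_simps)
    ultimately show ?thesis by blast
  qed
qed

lemma exists_spanning_layout:
  assumes "V \<noteq> {}"
  shows "\<exists>B. layout B \<and> set (seq B) = V"
proof -
  have "\<exists>B'. layout B' \<and> set (seq B') = V" if "layout B" "set (seq B) \<noteq> {}" for B
    using that
  proof (induction "card V - card (set (seq B))" arbitrary: B rule: less_induct)
    case less
    have BV: "set B \<subseteq> V \<inter> A" and tB: "t ` set (seq B) \<subseteq> set (seq B)"
      using less.prems unfolding layout_def by auto
    have mB: "m ` set (seq B) \<subseteq> set (seq B)" using BV inv(1) unfolding set_seq by auto
    have WV: "set (seq B) \<subseteq> V" using BV inV(1) unfolding set_seq by auto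
    show ?case
    proof (cases "set (seq B) = V")
      case False
      then obtain y where y: "y \<in> V" "y \<notin> set (seq B)" using WV by auto
      obtain x where "x \<in> set (seq B)" using less.prems(2) by (meson all_not_in_conv)
      note x = this y
      then have "(\<lambda>x y. y \<in> {m x, s x, t x})\<^sup>*\<^sup>* x y" using conn WV by blast
      then obtain u v where "u \<in> set (seq B)" "v \<notin> set (seq B)" "v \<in> {m u, s u, t u}"
        using rtranclp_leaves[of "\<lambda>x y. y \<in> {m x, s x, t x}" x y "set (seq B)"] x by blast
      \<comment> \<open>As the layout is closed under \<open>m\<close> and \<open>t\<close>,
        connectedness leads out of it along an \<open>s\<close>-edge.\<close>
      then have "u \<in> set (seq B)" "s u \<notin> set (seq B)" using mB tB by auto
      then obtain B' where B': "layout B'" "set (seq B) \<subset> set (seq B')" using layout_extend[OF less.prems(1)] by blast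
      have "set (seq B') \<subseteq> V" using B'(1) inV(1) unfolding layout_def set_seq by auto
      then have "card (set (seq B)) < card (set (seq B'))" "card (set (seq B')) \<le> card V"
        using B'(2) fin by (auto intro: psubset_card_mono card_mono)
      then show ?thesis using less.hyps[of B'] B' by fastforce
    qed (use less.prems in blast)
  qed
  moreover obtain v where "v \<in> V" using assms by auto
  then have "v \<in> V \<inter> A \<or> m v \<in> V \<inter> A" using inV inA by auto
  then obtain q where "q \<in> V \<inter> A" by blast
  then obtain C where C: "tour C" using exists_tour by metis
  then have "set (seq C) \<noteq> {}" unfolding tour_def set_seq by auto
  ultimately show ?thesis using layout_tour[OF C] by blast
qed

text \<open>The walk carries one unit from \<open>x\<close> to \<open>y\<close>, values adding up on
  repeated darts. One more unit from \<open>y\<close> back to \<open>x\<close> will complete it to a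
  flow.\<close>

lemma path_flow:
  assumes "(step L)\<^sup>*\<^sup>* x y" "x \<in> V"
  shows "\<exists>g :: 'a \<Rightarrow> 'a \<Rightarrow> 3. (\<forall>u v. g v u = - g u v) \<and> (\<forall>u v. \<not> step L u v \<longrightarrow> g u v = 0) \<and>
    (\<forall>v. (\<Sum>u\<in>V. g v u) = of_bool (v = x) - of_bool (v = y))"
  using assms(1)
proof (induction rule: rtranclp_induct)
  case base
  then show ?case by (intro exI[of _ "\<lambda>_ _. 0"]) simp
next
  case (step y z)
  then obtain g :: "'a \<Rightarrow> 'a \<Rightarrow> 3" where g1: "\<forall>u v. g v u = - g u v" and g2: "\<forall>u v. \<not> step L u v \<longrightarrow> g u v = 0"
    and g3: "\<forall>v. (\<Sum>u\<in>V. g v u) = of_bool (v = x) - of_bool (v = y)" by (elim exE conjE)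
  have yz: "y \<in> V" "z \<in> V" "step L z y"
    using step(2) step_sym[OF step(2)] unfolding step_def by auto
  define h where "h u v = g u v + (of_bool (u = y \<and> v = z) - of_bool (u = z \<and> v = y))" for u v
  have "h v u = - h u v" for u v
  proof -
    have a: "g v u = - g u v" by (rule g1[rule_format])
    show ?thesis unfolding h_def a by (simp add: conj_commute)
  qed
  moreover have "h u v = 0" if "\<not> step L u v" for u v
    using that g2 step(2) yz(3) unfolding h_def by auto
  moreover have "(\<Sum>u\<in>V. h v u) = of_bool (v = x) - of_bool (v = z)" for v
  proof -
    have "(\<Sum>u\<in>V. of_bool (v = y \<and> u = z)) = (of_bool (v = y) :: 3)"
         "(\<Sum>u\<in>V. of_bool (v = z \<and> u = y)) = (of_bool (v = z) :: 3)"
      using yz fin by (cases "v = y"; cases "v = z"; simp add: of_bool_def sum.delta)+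
    then show ?thesis unfolding h_def by (simp add: sum.distrib sum_subtractf g3[rule_format])
  qed
  ultimately show ?case by blast
qed

text \<open>Walking along the order from one end \<open>a\<close> of an \<open>s\<close>-edge to the other, one alternately follows
  an \<open>m\<close>-edge along a face \<open>\<phi>0\<close> and passes to the next vertex along a face \<open>\<phi>1\<close>, crossing an
  \<open>s\<close>-edge at every vertex. This closed walk in the dual graph annihilates every flow.\<close>

lemma dual_walk:
  fixes f :: "'a \<Rightarrow> 'a \<Rightarrow> 3"
  assumes lay: "layout B" "set (seq B) = V" and L: "seq B = xs @ a # ys @ s a # zs"
    and f: "flow V {(v, w). v \<in> V \<and> w \<in> {m v, s v, t v}} f"
  shows "(\<Sum>v\<in>set ys. f v (s v)) = 0"
proof -
  have BV: "set B \<subseteq> V \<inter> A" and dB: "distinct B" and J: "\<And>b b'. (b, b') \<in> darts B \<Longrightarrow> \<phi>1 (m b) = \<phi>1 b'"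
    using lay unfolding layout_def by auto
  obtain c where c: "\<And>v. v \<in> V \<inter> A \<Longrightarrow> f v (s v) = c (\<phi>1 v) - c (\<phi>0 v)" using potential[OF f] by blast
  \<comment> \<open>\<open>inn v\<close> and \<open>out v\<close> are the potentials just before and
    just after the walk crosses the \<open>s\<close>-edge at \<open>v\<close>. The two faces change
    roles with each vertex, because the order alternates between \<open>A\<close> and its
    complement.\<close>
  define inn where "inn v = (if v \<in> A then c (\<phi>1 v) else c (\<phi>0 v))" for v
  define out where "out v = (if v \<in> A then c (\<phi>0 v) else c (\<phi>1 v))" for v
  have fv: "f v (s v) = inn v - out v" if v: "v \<in> V" for v
  proof (cases "v \<in> A")
    case False
    have sv: "s v \<in> V \<inter> A" "s (s v) = v" using v False inV inA inv by auto
    have "f v (s v) = - f (s v) (s (s v))" using flowD(1)[OF f, of v "s v"] sv by simp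
    then show ?thesis using c[OF sv(1)] False faces[OF v] unfolding inn_def out_def by simp
  qed (use c v in \<open>simp add: inn_def out_def\<close>)
  have match: "out x = inn y" if "(x, y) \<in> darts (seq B)" for x y
  proof -
    from that consider "x \<in> set B" "y = m x" | b b' where "(b, b') \<in> darts B" "x = m b" "y = b'"
      unfolding darts_seq by auto
    then show ?thesis
    proof cases
      case 1
      then have x: "x \<in> V" "x \<in> A" using BV by auto
      then show ?thesis using 1 inA(1)[OF x(1)] faces(1)[OF x(1)] unfolding inn_def out_def by simp
    next
      case 2
      then have b: "b \<in> V" "b \<in> A" "b' \<in> A" using BV darts_in_set'[OF 2(1)] by auto
      then show ?thesis using 2 inA(1)[OF b(1)] J[OF 2(1)] unfolding inn_def out_def by simp
    qed
  qed
  have tele: "(\<Sum>v\<leftarrow>ys. inn v - out v) = out x - inn y" if "darts (x # ys @ [y]) \<subseteq> darts (seq B)" for x y ys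
    using that
  proof (induction ys arbitrary: x)
    case Nil
    then show ?case using match by simp
  next
    case (Cons v ys)
    have "(\<Sum>w\<leftarrow>ys. inn w - out w) = out v - inn y" using Cons by auto
    moreover have "out x = inn v" using Cons.prems match by simp
    ultimately show ?case by simp
  qed
  have "darts (a # ys @ [s a]) \<subseteq> darts (seq B)"
    using darts_append[of xs a "ys @ s a # zs"] darts_append[of "a # ys" "s a" zs] by (simp add: L le_supI1 le_supI2)
  then have sum: "(\<Sum>v\<leftarrow>ys. inn v - out v) = out a - inn (s a)" by (rule tele)
  have dL: "distinct (seq B)" using distinct_seq[OF dB BV] .
  have aV: "a \<in> V" "set ys \<subseteq> V" unfolding lay(2)[symmetric] L by auto
  \<comment> \<open>Just after \<open>a\<close> and just before \<open>s a\<close> the walk is in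
    the same face next to their \<open>s\<close>-edge; this closes it.\<close>
  have "out a = inn (s a)" using inA(2)[OF aV(1)] faces[OF aV(1)] unfolding inn_def out_def by auto
  then have "(\<Sum>v\<leftarrow>ys. inn v - out v) = 0" using sum by simp
  moreover have "distinct ys" using dL L by auto
  ultimately have "(\<Sum>v\<in>set ys. inn v - out v) = 0" by (simp add: sum_list_distinct_conv_sum_set)
  moreover have "(\<Sum>v\<in>set ys. f v (s v)) = (\<Sum>v\<in>set ys. inn v - out v)"
    using aV(2) fv by (intro sum.cong) auto
  ultimately show ?thesis by simp
qed

lemma before_split:
  assumes "before L a b"
  obtains xs ys zs where "L = xs @ a # ys @ b # zs"
proof -
  have "\<exists>xs ys zs. L = xs @ a # ys @ b # zs"
    using assms
  proof (induction L)
    case (Cons z L)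
    show ?case
    proof (cases "a = z \<and> b \<in> set L")
      case True
      then obtain ys zs where "L = ys @ b # zs" by (meson split_list)
      then show ?thesis using True by (intro exI[of _ "[]"] exI[of _ ys] exI[of _ zs]) simp
    next
      case False
      then obtain xs ys zs where "L = xs @ a # ys @ b # zs" using Cons by auto
      then show ?thesis by (intro exI[of _ "z # xs"] exI[of _ ys] exI[of _ zs]) simp
    qed
  qed simp
  then show ?thesis using that by blast
qed

text \<open>If \<open>s\<close>-edges at \<open>a\<close> and \<open>c\<close> cross, close up the \<open>s\<close>-edge at \<open>c\<close> by a path without further
  \<open>s\<close>-edges except between neighbours in the order: of the edges leaving the interval
  between \<open>a\<close> and \<open>s a\<close> this flow uses only one.\<close>

lemma noncrossing_s:
  assumes lay: "layout B" "set (seq B) = V"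
  shows "noncrossing s (seq B)"
  unfolding noncrossing_def
proof (intro allI notI, elim conjE)
  fix a c
  let ?L = "seq B"
  assume h: "before ?L a c" "before ?L c (s a)" "before ?L (s a) (s c)"
  have BV: "set B \<subseteq> V \<inter> A" and dB: "distinct B" using lay unfolding layout_def by auto
  have dL: "distinct ?L" using distinct_seq[OF dB BV] .
  obtain xs ys zs where L: "?L = xs @ a # ys @ s a # zs" using before_split[OF before_trans[OF dL h(1,2)]] .
  have mem: "c \<in> set ys" "s c \<notin> set ys"
    using dL h before_in_set[of _ a c] before_in_set[of _ "s a" "s c"] unfolding L
    by (auto simp: before_append dest: before_in_set)
  have Veq: "V = set xs \<union> {a, s a} \<union> set ys \<union> set zs" unfolding lay(2)[symmetric] L by auto
  then have aV: "a \<in> V" and ysV: "set ys \<subseteq> V" by blast+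
  then have V: "a \<in> V" "c \<in> V" "s c \<in> V" "set ys \<subseteq> V" using mem(1) inV(2) by blast+
  \<comment> \<open>As a step, an \<open>s\<close>-edge joins neighbours in the order, so it could
    leave the interval only to \<open>a\<close> or \<open>s a\<close>; but these two are partners of
    each other.\<close>
  have leave: "\<not> step ?L v (s v)" if v: "v \<in> set ys" "s v \<notin> set ys" for v
  proof
    assume "step ?L v (s v)"
    moreover have vV: "v \<in> V" using v V by auto
    ultimately have ad: "(v, s v) \<in> darts ?L \<or> (s v, v) \<in> darts ?L"
      using distinct_nbrs[OF vV] unfolding step_def by metis
    have "s v = a \<or> s v = s a"
    proof -
      have "s v \<in> insert a (insert (s a) (set ys))"
      proof (rule ccontr)
        assume n: "s v \<notin> insert a (insert (s a) (set ys))"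
        have b: "before ?L a v" "before ?L v (s a)" using v(1) unfolding L by (simp_all add: before_append)
        have "s v \<in> V" using vV inV by simp
        then have "s v \<in> set xs \<or> s v \<in> set zs" using n unfolding Veq by auto
        then have "before ?L (s v) a \<or> before ?L (s a) (s v)" unfolding L by (auto simp: before_append)
        then show False using ad b darts_no_between[OF dL] before_trans[OF dL] darts_before before_irrefl[OF dL] by metis
      qed
      then show ?thesis using v by auto
    qed
    then have "v = a \<or> v = s a" using inv(2)[OF vV] inv(2)[OF V(1)] by metis
    then show False using v(1) dL unfolding L by auto
  qed
  have "(step ?L)\<^sup>*\<^sup>* (s c) c" using lay V unfolding layout_def by auto
  then obtain g :: "'a \<Rightarrow> 'a \<Rightarrow> 3" where g1: "\<forall>u v. g v u = - g u v" and g2: "\<forall>u v. \<not> step ?L u v \<longrightarrow> g u v = 0"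
    and g3: "\<forall>v. (\<Sum>u\<in>V. g v u) = of_bool (v = s c) - of_bool (v = c)"
    using path_flow V(3) by (metis (no_types, lifting))
  define f where "f u v = g u v + (of_bool (u = c \<and> v = s c) - of_bool (u = s c \<and> v = c))" for u v
  have sc: "s (s c) = c" "s c \<noteq> c" using inv(2)[OF V(2)] inA(2)[OF V(2)] by auto
  have anti: "f v u = - f u v" for u v
  proof -
    have a: "g v u = - g u v" by (rule g1[rule_format])
    show ?thesis unfolding f_def a by (simp add: conj_commute)
  qed
  have flow: "flow V {(v, w). v \<in> V \<and> w \<in> {m v, s v, t v}} f"
    unfolding flow_def
  proof (intro conjI allI impI)
    show "f v u = - f u v" for u v by (rule anti)
    show "f u v = 0" if "(u, v) \<notin> {(v, w). v \<in> V \<and> w \<in> {m v, s v, t v}}" for u v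
    proof -
      have "\<not> step ?L u v" "\<not> (u = c \<and> v = s c)" "\<not> (u = s c \<and> v = c)"
        using that V sc(1) unfolding step_def by auto
      then show ?thesis using g2 unfolding f_def by auto
    qed
    show "(\<Sum>u\<in>V. f v u) = 0" for v
    proof -
      have "(\<Sum>u\<in>V. of_bool (v = c \<and> u = s c)) = (of_bool (v = c) :: 3)"
           "(\<Sum>u\<in>V. of_bool (v = s c \<and> u = c)) = (of_bool (v = s c) :: 3)"
        using V fin by (cases "v = c"; cases "v = s c"; simp add: of_bool_def sum.delta)+
      then show ?thesis unfolding f_def by (simp add: sum.distrib sum_subtractf g3[rule_format])
    qed
  qed
  have "0 = (\<Sum>v\<in>set ys. f v (s v))" using dual_walk[OF lay L flow] by simp
  also have "\<dots> = (\<Sum>v\<in>{v \<in> set ys. s v \<in> set ys}. f v (s v)) + (\<Sum>v\<in>{v \<in> set ys. s v \<notin> set ys}. f v (s v))"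
    by (subst sum.union_disjoint[symmetric]) (auto intro!: sum.cong)
  \<comment> \<open>An \<open>s\<close>-edge with both ends in the interval is counted twice with
    opposite signs. Exchanging the ends shows that the sum equals its negative, hence is zero modulo
    3.\<close>
  also have "(\<Sum>v\<in>{v \<in> set ys. s v \<in> set ys}. f v (s v)) = 0"
  proof -
    let ?I = "{v \<in> set ys. s v \<in> set ys}"
    have ss: "s (s v) = v" if "v \<in> ?I" for v using that V inv(2) by auto
    have "(\<Sum>v\<in>?I. f v (s v)) = (\<Sum>v\<in>?I. f (s v) v)"
      by (rule sum.reindex_bij_witness[of _ s s]) (use ss in auto)
    also have "\<dots> = (\<Sum>v\<in>?I. - f v (s v))" by (intro sum.cong refl anti)
    also have "\<dots> = - (\<Sum>v\<in>?I. f v (s v))" by (rule sum_negf)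
    finally have e: "(\<Sum>v\<in>?I. f v (s v)) = - (\<Sum>v\<in>?I. f v (s v))" .
    have "x = 0" if "x = - x" for x :: 3
      using that exhaust_3[of x] by auto
    then show ?thesis using e by blast
  qed
  also have "(\<Sum>v\<in>{v \<in> set ys. s v \<notin> set ys}. f v (s v)) = (\<Sum>v\<in>{v \<in> set ys. s v \<notin> set ys}. if v = c then 1 else 0)"
  proof (rule sum.cong[OF refl])
    fix v assume v: "v \<in> {v \<in> set ys. s v \<notin> set ys}"
    then have "g v (s v) = 0" "v \<noteq> s c" using leave g2 mem by auto
    then show "f v (s v) = (if v = c then 1 else 0)" unfolding f_def by auto
  qed
  also have "\<dots> = 1" using mem by (simp add: sum.delta)
  finally show False by simp
qed

lemma noncrossing_m:
  assumes lay: "layout B"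
  shows "noncrossing m (seq B)"
  unfolding noncrossing_def
proof (intro allI notI, elim conjE)
  fix a c
  let ?L = "seq B"
  assume h: "before ?L a c" "before ?L c (m a)" "before ?L (m a) (m c)"
  have BV: "set B \<subseteq> V \<inter> A" and dB: "distinct B" using lay unfolding layout_def by auto
  have dL: "distinct ?L" using distinct_seq[OF dB BV] .
  have "a \<in> set ?L" using before_in_set[OF h(1)] by simp
  then consider "a \<in> set B" | b where "b \<in> set B" "a = m b" unfolding set_seq by auto
  then show False
  proof cases
    case 1
    then have "(a, m a) \<in> darts ?L" unfolding darts_seq by simp
    then show False using darts_no_between[OF dL] h by metis
  next
    case 2
    then have "(m a, a) \<in> darts ?L" using BV inv(1)[of b] unfolding darts_seq by auto
    then show False using darts_before before_trans[OF dL] before_irrefl[OF dL] h by metis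
  qed
qed

theorem exists_order:
  assumes "V \<noteq> {}"
  obtains L where "distinct L" "set L = V" "noncrossing m L" "noncrossing s L" "noncrossing t L"
proof -
  obtain B where B: "layout B" "set (seq B) = V" using exists_spanning_layout[OF assms] by blast
  have "distinct (seq B)" using B(1) distinct_seq unfolding layout_def by auto
  moreover have "noncrossing t (seq B)" using B(1) unfolding layout_def by auto
  ultimately show ?thesis using that B noncrossing_m noncrossing_s by blast
qed

end

section \<open>The matching book thickness\<close>

text \<open>Each involution fills one page: its edges are pairwise disjoint, and a crossing of two
  of them is the pattern that \<open>noncrossing\<close> excludes.\<close>

lemma matching_book_embedding_3:
  assumes L: "distinct L" "set L = V" and nc: "noncrossing m L" "noncrossing s L" "noncrossing t L"
    and inv: "\<And>v. v \<in> V \<Longrightarrow> m (m v) = v" "\<And>v. v \<in> V \<Longrightarrow> s (s v) = v" "\<And>v. v \<in> V \<Longrightarrow> t (t v) = v"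
    and E: "\<And>e. e \<in> E \<Longrightarrow> \<exists>u\<in>V. e = {u, m u} \<or> e = {u, s u} \<or> e = {u, t u}"
    and EV: "\<And>e. e \<in> E \<Longrightarrow> e \<subseteq> V"
  shows "\<exists>ord page. matching_book_embedding V E 3 ord page"
proof -
  define ord where "ord v = (THE i. i < length L \<and> L ! i = v)" for v
  have ord: "ord v < length L \<and> L ! ord v = v" if "v \<in> V" for v
  proof -
    obtain i where i: "i < length L" "L ! i = v" using \<open>v \<in> V\<close> L by (metis in_set_conv_nth)
    then have "ord v = i" unfolding ord_def using L(1) by (intro the_equality) (auto simp: nth_eq_iff_index_eq)
    then show ?thesis using i by simp
  qed
  have ordb: "before L x y" if "ord x < ord y" "x \<in> V" "y \<in> V" for x y
    using before_nth[of "ord x" "ord y" L] that ord by metis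
  \<comment> \<open>An edge goes to the first involution that realises it; by \<open>E\<close> only
    \<open>t\<close>-edges are left for the default page 2.\<close>
  define page :: "'a set \<Rightarrow> nat" where "page e = (if \<exists>u\<in>V. e = {u, m u} then 0 else if \<exists>u\<in>V. e = {u, s u} then 1 else 2)" for e
  have pg: "(page e = 0 \<longrightarrow> (\<exists>u\<in>V. e = {u, m u})) \<and> (page e = 1 \<longrightarrow> (\<exists>u\<in>V. e = {u, s u})) \<and> (page e = 2 \<longrightarrow> (\<exists>u\<in>V. e = {u, t u}))"
    if "e \<in> E" for e
    using E[OF that] unfolding page_def by auto
  have page3: "page e = 0 \<or> page e = 1 \<or> page e = 2" for e unfolding page_def by auto
  have good: "e \<inter> f = {} \<and> \<not> crossing ord e f"
    if x: "noncrossing x L" "\<And>v. v \<in> V \<Longrightarrow> x (x v) = v" and e: "u \<in> V" "e = {u, x u}" "w \<in> V" "f = {w, x w}"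
      and ef: "e \<noteq> f" "e \<subseteq> V" "f \<subseteq> V" for x e f u w
  proof
    show "e \<inter> f = {}"
    proof (rule ccontr)
      assume "e \<inter> f \<noteq> {}"
      then have "u = w \<or> u = x w \<or> x u = w \<or> x u = x w" using e by auto
      then have "u = w \<or> u = x w" using x(2)[OF e(1)] x(2)[OF e(3)] by metis
      then have "e = f" using e x(2)[OF e(3)] by auto
      then show False using ef by simp
    qed
    show "\<not> crossing ord e f"
    proof
      assume "crossing ord e f"
      then obtain a b c d where c: "e = {a, b}" "f = {c, d}" "ord a < ord c" "ord c < ord b" "ord b < ord d"
        unfolding crossing_def by blast
      have "b = x a" using c(1) e(2) x(2)[OF e(1)] c(3,4) by (auto simp: doubleton_eq_iff)
      moreover have "d = x c" using c(2) e(4) x(2)[OF e(3)] c(4,5) by (auto simp: doubleton_eq_iff)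
      moreover have "a \<in> V" "b \<in> V" "c \<in> V" "d \<in> V" using c(1,2) ef(2,3) by auto
      ultimately show False using x(1) ordb c(3-5) unfolding noncrossing_def by blast
    qed
  qed
  have "inj_on ord V" using ord by (metis inj_onI)
  moreover have "page e < 3" for e unfolding page_def by simp
  moreover have "e \<inter> f = {} \<and> \<not> crossing ord e f" if ef: "e \<in> E" "f \<in> E" "e \<noteq> f" "page e = page f" for e f
  proof -
    have g: ?thesis if "noncrossing x L" "\<And>v. v \<in> V \<Longrightarrow> x (x v) = v" "\<exists>u\<in>V. e = {u, x u}" "\<exists>u\<in>V. f = {u, x u}" for x
      using good[OF that(1,2)] that(3,4) ef(3) EV[OF ef(1)] EV[OF ef(2)] by (elim bexE) blast
    consider "page e = 0" | "page e = 1" | "page e = 2" using page3[of e] by argo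
    then show ?thesis
      using pg[OF ef(1)] pg[OF ef(2)] ef(4) g[OF nc(1) inv(1)] g[OF nc(2) inv(2)] g[OF nc(3) inv(3)] by cases simp_all
  qed
  ultimately show ?thesis unfolding matching_book_embedding_def by blast
qed

text \<open>Edges that share the vertex \<open>v\<close> are not disjoint, so their pages are all
  different.\<close>

lemma matching_book_embedding_ge_degree:
  assumes "matching_book_embedding V E k ord page" "finite E"
  shows "degree E v \<le> k"
proof -
  let ?E = "{e \<in> E. v \<in> e}"
  have "inj_on page ?E"
    using assms(1) unfolding matching_book_embedding_def inj_on_def by blast
  moreover have "page ` ?E \<subseteq> {..<k}" using assms(1) unfolding matching_book_embedding_def by auto
  ultimately have "card ?E \<le> card {..<k}" by (intro card_inj_on_le) auto
  then show ?thesis unfolding degree_def by simp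
qed

theorem theorem4p1:
  fixes V :: "'a set" and E :: "'a set set"
  assumes "simple_graph V E"
    and "connected_graph V E"
    and "bipartite V E"
    and "cubic V E"
    and "planar V E"
  shows "dispersable V E \<and> mbt V E = 3"
proof -
  obtain A where A: "\<And>e. e \<in> E \<Longrightarrow> card (e \<inter> A) = 1" using assms(3) unfolding bipartite_def by auto
  obtain pos :: "'a \<Rightarrow> complex" and \<gamma> where pos: "inj_on pos V"
      "\<forall>e\<in>E. arc (\<gamma> e) \<and> {pathstart (\<gamma> e), pathfinish (\<gamma> e)} = pos ` e \<and> path_image (\<gamma> e) \<inter> pos ` V = pos ` e"
      "\<forall>e\<in>E. \<forall>f\<in>E. e \<noteq> f \<longrightarrow> path_image (\<gamma> e) \<inter> path_image (\<gamma> f) \<subseteq> pos ` (e \<inter> f)"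
    using assms(5) unfolding planar_def by (elim exE conjE)
  interpret plane_graph V E pos \<gamma>
    by unfold_locales (use assms(1) pos in simp_all)
  have ne: "V \<noteq> {}" using assms(2) unfolding connected_graph_def by simp
  obtain \<F> where "plane_faces edarts \<F>"
    using exists_plane_faces[OF assms(2,4) bipartite_cubic_no_bridge[OF assms(1) A assms(4)]] by blast
  then obtain m s t and \<phi>0 \<phi>1 :: "'a \<Rightarrow> ('a \<times> 'a) set" where tri: "tricoloured V A m s t \<phi>0 \<phi>1"
    and E: "\<forall>u v. {u, v} \<in> E \<longleftrightarrow> u \<in> V \<and> v \<in> {m u, s u, t u}"
    using exists_tricolouring[OF assms(2,4) A] by blast
  interpret T: tricoloured V A m s t \<phi>0 \<phi>1 by (rule tri)
  obtain L where L: "distinct L" "set L = V" "noncrossing m L" "noncrossing s L" "noncrossing t L"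
    using T.exists_order[OF ne] .
  have EV: "e \<subseteq> V" "card e = 2" if "e \<in> E" for e using that assms(1) unfolding simple_graph_def by auto
  have "\<exists>ord page. matching_book_embedding V E 3 ord page"
  proof (rule matching_book_embedding_3[OF L T.inv])
    fix e assume e: "e \<in> E"
    then obtain u v where "e = {u, v}" using EV(2)[OF e] by (auto simp: card_2_iff)
    then show "\<exists>u\<in>V. e = {u, m u} \<or> e = {u, s u} \<or> e = {u, t u}" using E e by auto
  qed (use EV in auto)
  moreover have "E \<subseteq> Pow V" using EV by auto
  then have fin: "finite E" using finite_V finite_subset by blast
  have deg: "degree E v = 3" if "v \<in> V" for v using that assms(4) unfolding cubic_def by auto
  \<comment> \<open>Minimality: any single vertex has degree three and so requires three
    pages.\<close>
  have "3 \<le> k" if "\<exists>ord page. matching_book_embedding V E k ord page" for k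
    using that matching_book_embedding_ge_degree[OF _ fin] deg ne by (metis ex_in_conv)
  ultimately have "mbt V E = 3" unfolding mbt_def by (intro Least_equality)
  moreover have "degree E ` V = {3}" using deg ne by auto
  then have "max_degree V E = 3" unfolding max_degree_def by simp
  ultimately show ?thesis unfolding dispersable_def by simp
qed

end
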